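(* Let $\mathcal P$ be a countable set with a map $N:\mathcal P\to\mathbb Z_{>1}$, let $\mathcal M$ be the free abelian monoid (written additively) generated by $\mathcal P$, and extend $N$ to a monoid homomorphism $N:(\mathcal M,+)\to(\mathbb N,\cdot)$. Let $X$ be either $\mathbb Q$ or $\{q^z: z\in\mathbb Z\}$ for some integer $q>1$, with $N(\mathcal M)\subseteq X$. Assume there are constants $\kappa>0$ and $0\le\theta<1$ such that, for sufficiently large $x\in X$, $\#\{\mathfrak m\in\mathcal M: N(\mathfrak m)\le x\}=\kappa x+O(x^\theta)$. Let $h\ge2$ be an integer, and for $x\in X$ let $\mathcal N_h(x)$ be the set of $h$-full elements $\mathfrak m\in\mathcal M$ with $N(\mathfrak m)\le x$. Then for any $\epsilon>0$, the number of $\mathfrak m\in\mathcal N_h(x)$ that do not satisfy the inequality $$(1-\epsilon)\log\log N(\mathfrak m)\le\omega(\mathfrak m)\le(1+\epsilon)\log\log N(\mathfrak m)$$ is $o(|\mathcal N_h(x)|)$ as $x\to\infty$ (through $X$).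
   Context: Each $\mathfrak m\in\mathcal M$ is written uniquely as $\mathfrak m=\sum_{\mathfrak p\in\mathcal P}n_{\mathfrak p}(\mathfrak m)\,\mathfrak p$ with $n_{\mathfrak p}(\mathfrak m)\in\mathbb N\cup\{0\}$, all but finitely many equal to $0$; $N(\mathfrak m)=\prod_{\mathfrak p}N(\mathfrak p)^{n_{\mathfrak p}(\mathfrak m)}$. $\omega(\mathfrak m)$ is the number of $\mathfrak p\in\mathcal P$ with $n_{\mathfrak p}(\mathfrak m)\ge1$. The element $\mathfrak m$ is $h$-full if $n_{\mathfrak p}(\mathfrak m)\ge h$ for every $\mathfrak p$ with $n_{\mathfrak p}(\mathfrak m)\ge1$. The element $0$ (of norm $1$, where $\log\log N$ is undefined) is disregarded. *)

theory Defs
  imports Complex_Main "HOL-Library.Multiset" "HOL-Library.Countable_Set"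
    "HOL-Library.Landau_Symbols"
begin

text \<open>
  The free abelian monoid on \<open>P\<close> is the set of finite multisets over \<open>P\<close>: the exponent
  of \<open>p\<close> in \<open>m\<close> is \<open>count m p\<close>.
\<close>

definition free_abelian_monoid :: "'p set \<Rightarrow> 'p multiset set" where
  "free_abelian_monoid P = {m. set_mset m \<subseteq> P}"

definition norm_ext :: "('p \<Rightarrow> nat) \<Rightarrow> 'p multiset \<Rightarrow> nat" where
  "norm_ext N m = (\<Prod>p\<in>set_mset m. N p ^ count m p)"

definition omega :: "'p multiset \<Rightarrow> nat" where
  "omega m = card {p. count m p \<ge> 1}"

definition h_full :: "nat \<Rightarrow> 'p multiset \<Rightarrow> bool" where
  "h_full h m \<longleftrightarrow> (\<forall>p. count m p \<ge> 1 \<longrightarrow> count m p \<ge> h)"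

definition h_full_upto :: "'p set \<Rightarrow> ('p \<Rightarrow> nat) \<Rightarrow> nat \<Rightarrow> real \<Rightarrow> 'p multiset set" where
  "h_full_upto P N h x = {m \<in> free_abelian_monoid P. h_full h m \<and> real (norm_ext N m) \<le> x}"

text \<open>The filter of \<open>x \<rightarrow> \<infinity>\<close> through \<open>X\<close>.\<close>

definition at_top_through :: "real set \<Rightarrow> real filter" where
  "at_top_through X = inf at_top (principal X)"

text \<open>
  The counting hypothesis. Although \<open>card\<close> of an infinite set is \<open>0\<close>, for \<open>\<kappa> > 0\<close>
  and \<open>\<theta> < 1\<close> the condition forces the counted sets to be finite whenever \<open>X\<close> is unbounded
  above: otherwise the counts would eventually be \<open>0\<close>, and \<open>\<kappa> x\<close> is not \<open>O(x powr \<theta>)\<close>.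
\<close>

definition counting_condition ::
  "'p set \<Rightarrow> ('p \<Rightarrow> nat) \<Rightarrow> real set \<Rightarrow> real \<Rightarrow> real \<Rightarrow> bool" where
  "counting_condition P N X \<kappa> \<theta> \<longleftrightarrow>
     (\<lambda>x. real (card {m \<in> free_abelian_monoid P. real (norm_ext N m) \<le> x}) - \<kappa> * x)
       \<in> O[at_top_through X](\<lambda>x. x powr \<theta>)"

end

theory Submission
  imports Defs "HOL-Library.FuncSet"
begin

text \<open>
  An \<open>h\<close>-full element is, up to a small perturbation, an \<open>h\<close>-th power: it can be written as
  \<open>h * a + b\<close> (in additive notation), where \<open>a\<close> is arbitrary and all nonzero exponents of \<open>b\<close> lie
  strictly between \<open>h\<close> and \<open>2 * h\<close> (\<open>h_full_decomposition\<close>). The sum of \<open>N(b) powr - (1 / h)\<close>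
  over all such \<open>b\<close> converges, even with a slightly smaller exponent
  (\<open>powr_sum_cofactors_bounded\<close>). Hence the number of \<open>h\<close>-full elements up to \<open>x\<close> has the order
  \<open>x powr (1 / h)\<close>, and all but a small proportion of them have \<open>N(b) \<le> B\<close> for a constant \<open>B\<close>.
  There are finitely many such \<open>b\<close>, and for each of them both \<open>omega(h * a + b) - omega(a)\<close> and
  \<open>ln (ln N(h * a + b)) - ln (ln N(a))\<close> are bounded, apart from elements of small norm. So the
  statement for \<open>h\<close>-full elements follows from the statement that \<open>omega\<close> has the normal order
  \<open>ln (ln N)\<close> on the whole monoid.

  For the whole monoid (\<open>normal_order\<close>), the argument is Turan's. The variance of the number of prime
  divisors of norm at most \<open>z = x powr ((1 - \<theta>) / 2)\<close> is computed by counting the multiples of one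
  generator and of products of two (\<open>Turan_second_moment\<close>); this is where the power saving in the counting
  hypothesis enters. The mean is the sum \<open>L(z)\<close> of \<open>1 / N(p)\<close> over the generators up to \<open>z\<close>, and the
  variance is of order \<open>L(z)\<close> as well. Generators of larger norm contribute a bounded number of
  divisors.

  It remains to see that \<open>L(z)\<close> is asymptotic to \<open>ln (ln z)\<close> (\<open>recip_sum_asymp\<close>). As a relative error
  that tends to zero is good enough, two comparisons with Euler products suffice: the harmonic sum
  over all elements up to \<open>x\<close> gives the lower bound, and the sum of \<open>N(m) powr - s\<close> over squarefree
  elements, with \<open>s = 1 + \<delta> / ln x\<close> and \<open>\<delta>\<close> small, gives the upper bound. Both
  require linear upper and lower bounds for the counting function only, which also hold when the norms
  are powers of a fixed integer.
\<close>

section \<open>Norms and finite Euler products\<close>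

lemma norm_ext_prod_mset: "norm_ext N m = prod_mset (image_mset N m)"
  by (simp add: norm_ext_def image_prod_mset_multiplicity)

lemma norm_ext_empty [simp]: "norm_ext N {#} = 1"
  by (simp add: norm_ext_prod_mset)

lemma norm_ext_single [simp]: "norm_ext N {#p#} = N p"
  by (simp add: norm_ext_prod_mset)

lemma norm_ext_add: "norm_ext N (a + b) = norm_ext N a * norm_ext N b"
  by (simp add: norm_ext_prod_mset)

lemma norm_ext_repeat: "norm_ext N (repeat_mset k a) = norm_ext N a ^ k"
  by (induction k) (simp_all add: norm_ext_add)

lemma omega_eq_card_set_mset: "omega m = card (set_mset m)"
proof -
  have "{p. count m p \<ge> 1} = set_mset m"
    by (auto simp: Suc_le_eq)
  then show ?thesis by (simp add: omega_def)
qed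

lemma powr_norm_ext:
  assumes "finite Q" "set_mset m \<subseteq> Q" "\<And>p. p \<in> Q \<Longrightarrow> N p > 0"
  shows "real (norm_ext N m) powr s = (\<Prod>p\<in>Q. (real (N p) powr s) ^ count m p)"
proof -
  have "real (norm_ext N m) = (\<Prod>p\<in>set_mset m. real (N p) ^ count m p)"
    by (simp add: norm_ext_def)
  also have "\<dots> = (\<Prod>p\<in>Q. real (N p) ^ count m p)"
    using assms by (intro prod.mono_neutral_left) (auto simp: not_in_iff)
  finally have "real (norm_ext N m) powr s = (\<Prod>p\<in>Q. (real (N p) ^ count m p) powr s)"
    by (simp add: prod_powr_distrib)
  also have "\<dots> = (\<Prod>p\<in>Q. (real (N p) powr s) ^ count m p)"
    using assms(3) by (intro prod.cong refl) (simp add: powr_power powr_realpow [symmetric] powr_powr mult.commute)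
  finally show ?thesis .
qed

lemma ex_multiset_count:
  assumes "finite {p. f p > 0}"
  shows "\<exists>m. count m = (f :: 'a \<Rightarrow> nat)"
  using assms count_Abs_multiset by blast

text \<open>
  Expanding a finite product of sums over exponents gives one term for every choice of an exponent
  at each generator, that is, for every element of the free monoid with exponents in \<open>J\<close>. Every
  comparison between sums over elements and sums over generators below passes through this finite
  form of the Euler product.
\<close>

lemma Euler_product_le:
  assumes Q: "finite Q" and pos: "\<And>p. p \<in> Q \<Longrightarrow> N p > 0"
    and J: "finite J" and T: "finite T"
    and sub: "\<And>m. m \<in> T \<Longrightarrow> set_mset m \<subseteq> Q \<and> (\<forall>p\<in>Q. count m p \<in> J)"
  shows "(\<Sum>m\<in>T. real (norm_ext N m) powr s) \<le> (\<Prod>p\<in>Q. \<Sum>j\<in>J. (real (N p) powr s) ^ j)"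
proof -
  let ?r = "\<lambda>m. restrict (count m) Q"
  have inj: "inj_on ?r T"
  proof (rule inj_onI)
    fix m m' assume *: "m \<in> T" "m' \<in> T" "?r m = ?r m'"
    show "m = m'"
    proof (rule multiset_eqI)
      fix p
      show "count m p = count m' p"
      proof (cases "p \<in> Q")
        case True
        then show ?thesis using *(3) by (metis restrict_apply')
      next
        case False
        then have "p \<notin># m" "p \<notin># m'" using * sub by auto
        then show ?thesis by (simp add: not_in_iff)
      qed
    qed
  qed
  have "(\<Sum>m\<in>T. real (norm_ext N m) powr s) = (\<Sum>m\<in>T. \<Prod>p\<in>Q. (real (N p) powr s) ^ ?r m p)"
    using sub pos by (intro sum.cong refl) (subst powr_norm_ext[OF Q], auto)
  also have "\<dots> = (\<Sum>g\<in>?r ` T. \<Prod>p\<in>Q. (real (N p) powr s) ^ g p)"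
    by (simp add: sum.reindex[OF inj])
  also have "\<dots> \<le> (\<Sum>g\<in>Q \<rightarrow>\<^sub>E J. \<Prod>p\<in>Q. (real (N p) powr s) ^ g p)"
    using sub Q J by (intro sum_mono2 finite_PiE prod_nonneg) (auto split: if_splits)
  also have "\<dots> = (\<Prod>p\<in>Q. \<Sum>j\<in>J. (real (N p) powr s) ^ j)"
    using Q J by (simp add: prod_sum_PiE)
  finally show ?thesis .
qed

text \<open>
  With the exponents \<open>0\<close> and \<open>1\<close> the expansion is used in the other direction: it turns an upper
  bound for sums over elements into an upper bound for sums over generators.
\<close>

lemma squarefree_Euler_product:
  assumes Q: "finite Q" and pos: "\<And>p. p \<in> Q \<Longrightarrow> N p > 0"
  shows "(\<Prod>p\<in>Q. 1 + real (N p) powr s) = (\<Sum>m\<in>mset_set ` Pow Q. real (norm_ext N m) powr s)"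
proof -
  have inj: "inj_on mset_set (Pow Q)"
    using Q by (intro inj_onI) (metis finite_set_mset_mset_set PowD finite_subset)
  have "(\<Prod>p\<in>Q. 1 + real (N p) powr s) = (\<Sum>S\<in>Pow Q. \<Prod>p\<in>S. real (N p) powr s)"
    using prod_add[OF Q, of "\<lambda>p. real (N p) powr s" "\<lambda>_. 1"] by (simp add: add.commute)
  also have "\<dots> = (\<Sum>S\<in>Pow Q. real (norm_ext N (mset_set S)) powr s)"
  proof (intro sum.cong refl)
    fix S assume "S \<in> Pow Q"
    then have "finite S" "S \<subseteq> Q" using Q finite_subset by auto
    then show "(\<Prod>p\<in>S. real (N p) powr s) = real (norm_ext N (mset_set S)) powr s"
      by (simp add: norm_ext_def prod_powr_distrib)
  qed
  also have "\<dots> = (\<Sum>m\<in>mset_set ` Pow Q. real (norm_ext N m) powr s)"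
    by (simp add: sum.reindex[OF inj])
  finally show ?thesis .
qed

lemma set_mset_repeat_mset: "k \<ge> 1 \<Longrightarrow> set_mset (repeat_mset k a) = set_mset a"
  by (auto simp flip: count_greater_zero_iff)

lemma omega_repeat_mset_add:
  assumes "h \<ge> 1"
  shows "omega a \<le> omega (repeat_mset h a + b)" "omega (repeat_mset h a + b) \<le> omega a + omega b"
proof -
  have "set_mset (repeat_mset h a + b) = set_mset a \<union> set_mset b"
    using assms by (simp add: set_mset_repeat_mset)
  then show "omega a \<le> omega (repeat_mset h a + b)" "omega (repeat_mset h a + b) \<le> omega a + omega b"
    by (simp_all add: omega_eq_card_set_mset card_mono card_Un_le)
qed

section \<open>Auxiliary estimates for logarithms and exponentials\<close>

text \<open>
  Turns an Euler product into the exponential of a sum over generators.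
\<close>

lemma prod_le_exp_sum:
  fixes f g :: "'a \<Rightarrow> real"
  assumes "finite Q" "\<And>p. p \<in> Q \<Longrightarrow> 0 \<le> f p" "\<And>p. p \<in> Q \<Longrightarrow> f p \<le> exp (g p)"
  shows "prod f Q \<le> exp (sum g Q)"
  using assms by (simp add: exp_sum prod_mono)

lemma eventually_lnln_ge: "eventually (\<lambda>x::real. k \<le> ln (ln x)) at_top"
proof -
  have "filterlim (\<lambda>x::real. ln (ln x)) at_top at_top" by (rule filterlim_compose[OF ln_at_top ln_at_top])
  then show ?thesis by (auto simp: filterlim_at_top)
qed

text \<open>
  Dividing \<open>x\<close> by \<open>n\<close> halves \<open>ln x\<close> at worst, and the root divides it by \<open>h\<close>, so that the
  iterated logarithm moves by a bounded amount, uniformly in \<open>n \<le> sqrt x\<close>.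
\<close>

lemma lnln_compare:
  fixes y :: real
  assumes h: "h \<ge> 1" and x: "x \<ge> exp 1" "x \<ge> n\<^sup>2" and n: "n \<ge> 1"
  shows "\<bar>ln (ln ((x / n) powr (1 / real h))) - ln (ln x)\<bar> \<le> ln 2 + ln (real h)"
proof -
  have xpos: "x > 0" using x(1) exp_gt_zero[of "1::real"] by linarith
  have lnx: "ln x \<ge> 1" using x(1) xpos by (simp add: ln_ge_iff)
  have "ln (n\<^sup>2) \<le> ln x" using x(2) n xpos by (subst ln_le_cancel_iff) auto
  then have n2: "ln n \<le> ln x / 2" using n by (simp add: ln_realpow)
  define l where "l = ln x - ln n"
  have l: "ln x / 2 \<le> l" "l \<le> ln x" using n2 n by (simp_all add: l_def)
  then have lpos: "l > 0" using lnx by linarith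
  have "ln ((x / n) powr (1 / real h)) = l / real h"
    using xpos n by (simp add: ln_powr ln_div l_def)
  then have *: "ln (ln ((x / n) powr (1 / real h))) = ln l - ln (real h)"
    using lpos h by (simp add: ln_div)
  have "ln (ln x / 2) \<le> ln l" "ln l \<le> ln (ln x)"
    using l lnx lpos by (auto intro: ln_mono)
  moreover have "ln (ln x / 2) = ln (ln x) - ln 2" using lnx by (simp add: ln_div)
  moreover have "ln (real h) \<ge> 0" "ln (2::real) \<ge> 0" using h by simp_all
  ultimately show ?thesis using * by linarith
qed

section \<open>Decomposition of h-full elements\<close>

text \<open>
  Write an exponent \<open>e \<ge> h\<close> as \<open>h * q + r\<close> with \<open>r < h\<close>. If \<open>r = 0\<close>, all of it goes into the
  \<open>h\<close>-th power; otherwise one multiple of \<open>h\<close> is kept back, so that the second summand has the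
  exponent \<open>h + r\<close>, which exceeds \<open>h\<close>. This strict inequality makes the sum of the
  \<open>(1/h)\<close>-th powers of the inverse norms of the possible \<open>b\<close> converge.
\<close>

lemma h_full_decomposition:
  assumes h: "h \<ge> 1" and m: "h_full h m"
  obtains a b where "m = repeat_mset h a + b"
    "\<And>p. count b p = 0 \<or> h < count b p \<and> count b p < 2 * h"
proof -
  define f where "f = (\<lambda>p. if count m p mod h = 0 then 0 else h + count m p mod h)"
  define g where "g = (\<lambda>p. (count m p - f p) div h)"
  have eq: "count m p = h * g p + f p" for p
  proof (cases "count m p mod h = 0")
    case True
    then have "h dvd count m p" by auto
    then show ?thesis using True by (simp add: f_def g_def)
  next
    case False
    then have "count m p \<ge> 1" by (cases "count m p") auto
    then have "count m p \<ge> h" using m unfolding h_full_def by blast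
    then obtain q where q: "count m p div h = Suc q"
      using h by (metis div_greater_zero_iff gr0_conv_Suc less_le_trans zero_less_one)
    have "count m p = h * Suc q + count m p mod h" by (metis q mult_div_mod_eq)
    then have "count m p - f p = h * q" using False by (simp add: f_def)
    then show ?thesis using False h \<open>count m p = h * Suc q + count m p mod h\<close> by (simp add: g_def f_def)
  qed
  have "count m p > 0" if "f p > 0 \<or> g p > 0" for p
    using that h eq[of p] by auto
  then have "{p. f p > 0} \<subseteq> set_mset m" "{p. g p > 0} \<subseteq> set_mset m"
    by auto
  then have "finite {p. f p > 0}" "finite {p. g p > 0}" using finite_subset finite_set_mset by blast+
  then obtain a b where a: "count a = g" and b: "count b = f" using ex_multiset_count by metis
  have "m = repeat_mset h a + b" by (rule multiset_eqI) (simp add: a b eq)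
  moreover have "count b p = 0 \<or> h < count b p \<and> count b p < 2 * h" for p
    using h by (simp add: b f_def)
  ultimately show ?thesis by (rule that)
qed

section \<open>Monoids with a linear counting function\<close>

text \<open>
  The counting hypothesis in the form in which it is used. The asymptotic formula holds at points of
  \<open>X\<close> only; if \<open>X\<close> is a geometric progression, the counting function is a step function for which
  no such formula holds at all real points. At real points there remain the two-sided linear bounds and
  the possibility to replace \<open>y\<close> by a point of \<open>X\<close> with the same elements below it.
\<close>

locale counted_monoid =
  fixes P :: "'p set" and N :: "'p \<Rightarrow> nat" and X :: "real set" and \<kappa> \<theta> c C :: real
  assumes N_gt_1: "p \<in> P \<Longrightarrow> N p > 1"
    and \<kappa>_pos: "\<kappa> > 0" and \<theta>_nonneg: "0 \<le> \<theta>" and \<theta>_less_1: "\<theta> < 1" and c_pos: "c > 0"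
    and finite_upto: "finite {m \<in> free_abelian_monoid P. real (norm_ext N m) \<le> y}"
    and count_ge: "y \<ge> 1 \<Longrightarrow>
      c * y \<le> real (card {m \<in> free_abelian_monoid P. real (norm_ext N m) \<le> y})"
    and count_le: "y \<ge> 1 \<Longrightarrow>
      real (card {m \<in> free_abelian_monoid P. real (norm_ext N m) \<le> y}) \<le> C * y"
    and count_asymp: "x \<in> X \<Longrightarrow> x \<ge> 1 \<Longrightarrow>
      \<bar>real (card {m \<in> free_abelian_monoid P. real (norm_ext N m) \<le> x}) - \<kappa> * x\<bar> \<le> C * x powr \<theta>"
    and X_divide: "x \<in> X \<Longrightarrow> m \<in> free_abelian_monoid P \<Longrightarrow> x / real (norm_ext N m) \<in> X"
    and X_round_down: "y \<ge> 1 \<Longrightarrow> \<exists>x\<in>X. 1 \<le> x \<and> x \<le> y \<and>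
      {m \<in> free_abelian_monoid P. real (norm_ext N m) \<le> y} =
      {m \<in> free_abelian_monoid P. real (norm_ext N m) \<le> x}"
begin

abbreviation nrm :: "'p multiset \<Rightarrow> real" where
  "nrm m \<equiv> real (norm_ext N m)"

definition elems_upto :: "real \<Rightarrow> 'p multiset set" where
  "elems_upto y = {m \<in> free_abelian_monoid P. nrm m \<le> y}"

definition primes_upto :: "real \<Rightarrow> 'p set" where
  "primes_upto z = {p \<in> P. real (N p) \<le> z}"

definition recip_sum :: "real \<Rightarrow> real" where
  "recip_sum z = (\<Sum>p\<in>primes_upto z. 1 / real (N p))"

lemma finite_elems_upto [simp]: "finite (elems_upto y)"
  using finite_upto by (simp add: elems_upto_def)

lemma count_bounds:
  assumes "y \<ge> 1"
  shows "c * y \<le> real (card (elems_upto y))" "real (card (elems_upto y)) \<le> C * y"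
  using count_ge[OF assms] count_le[OF assms] by (simp_all add: elems_upto_def)

lemma C_ge_1: "C \<ge> 1"
proof -
  have "{#} \<in> elems_upto 1" by (simp add: elems_upto_def free_abelian_monoid_def)
  then have "card (elems_upto 1) \<ge> 1"
    using card_0_eq[OF finite_elems_upto, of 1] by (metis Suc_leI One_nat_def bot_nat_0.not_eq_extremum empty_iff)
  then show ?thesis using count_bounds(2)[of 1] by simp
qed

lemma c_le_C: "c \<le> C"
  using count_bounds[of 1] by simp

lemma elems_upto_mono: "y \<le> z \<Longrightarrow> elems_upto y \<subseteq> elems_upto z"
  by (auto simp: elems_upto_def)

text \<open>
  The rounded point is not much smaller than \<open>y\<close> because the counts, which agree, are linear in size.
\<close>

lemma round_down:
  assumes "y \<ge> 1"
  obtains x where "x \<in> X" "1 \<le> x" "x \<le> y" "c / C * y \<le> x" "elems_upto y = elems_upto x"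
proof -
  obtain x where x: "x \<in> X" "1 \<le> x" "x \<le> y" "elems_upto y = elems_upto x"
    using X_round_down[OF assms] by (auto simp: elems_upto_def)
  have "c * y \<le> C * x"
    using count_bounds[OF assms] count_bounds[OF x(2)] x(4) by simp
  then have "c / C * y \<le> x"
    using C_ge_1 by (simp add: field_simps)
  with x that show ?thesis by blast
qed

lemma N_ge_2: "p \<in> P \<Longrightarrow> real (N p) \<ge> 2"
  using N_gt_1[of p] by linarith

lemma nrm_ge_1:
  assumes "m \<in> free_abelian_monoid P"
  shows "nrm m \<ge> 1"
proof -
  have "N p \<noteq> 0" if "p \<in># m" for p
    using that assms N_gt_1[of p] by (auto simp: free_abelian_monoid_def)
  then have "norm_ext N m \<noteq> 0"
    by (auto simp: norm_ext_def)
  then show ?thesis by simp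
qed

lemma nrm_ge_power_size:
  assumes "m \<in> free_abelian_monoid P"
  shows "nrm m \<ge> 2 ^ size m"
  using assms
proof (induction m)
  case (add p m)
  then have "p \<in> P" "2 ^ size m \<le> nrm m"
    by (auto simp: free_abelian_monoid_def)
  moreover have "nrm (add_mset p m) = real (N p) * nrm m"
    by (simp add: norm_ext_prod_mset)
  ultimately show ?case using N_ge_2[of p] by (simp add: mult_mono)
qed simp

lemma finite_primes_upto [simp]: "finite (primes_upto z)"
  and card_primes_upto: "card (primes_upto z) \<le> card (elems_upto z)"
proof -
  have sub: "(\<lambda>p. {#p#}) ` primes_upto z \<subseteq> elems_upto z"
    by (auto simp: primes_upto_def elems_upto_def free_abelian_monoid_def)
  have inj: "inj_on (\<lambda>p. {#p#}) (primes_upto z)"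
    by (simp add: inj_on_def)
  show "finite (primes_upto z)"
    using finite_imageD[OF finite_subset[OF sub finite_elems_upto] inj] .
  show "card (primes_upto z) \<le> card (elems_upto z)"
    using card_inj_on_le[OF inj sub finite_elems_upto] .
qed

text \<open>
  Dyadic decomposition: at most \<open>C * 2 ^ (k + 1)\<close> elements have a norm near \<open>2 ^ k\<close>, which leaves
  a geometric series. The bound is uniform over all finite \<open>T\<close> and thus stands in for the
  convergence of the zeta function at \<open>s\<close>, with the order of growth of its pole at \<open>1\<close>.
\<close>

lemma nrm_powr_sum_le:
  assumes T: "finite T" "T \<subseteq> free_abelian_monoid P" and s: "s > 1"
  shows "(\<Sum>m\<in>T. nrm m powr - s) \<le> 2 * C / (1 - 2 powr (1 - s))"
proof -
  define r :: real where "r = 2 powr (1 - s)"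
  have r: "0 < r" "r < 1" using s by (simp_all add: r_def powr_less_one)
  obtain K where K: "\<And>m. m \<in> T \<Longrightarrow> nrm m < 2 ^ K"
  proof -
    obtain B where B: "\<forall>m\<in>T. nrm m \<le> B"
      using T(1) by (meson finite_imageI bdd_above_finite bdd_above.unfold imageI)
    obtain K :: nat where "B < 2 ^ K" using real_arch_pow[of 2 B] by auto
    with B have "\<And>m. m \<in> T \<Longrightarrow> nrm m < 2 ^ K" by (meson order_le_less_trans)
    then show ?thesis by (rule that)
  qed
  have "(\<Sum>m\<in>T. nrm m powr - s) \<le> (\<Sum>m\<in>T. \<Sum>k<K. if 2 ^ k \<le> nrm m \<and> nrm m \<le> 2 ^ Suc k then (2 ^ k) powr - s else 0)"
  proof (intro sum_mono)
    fix m assume m: "m \<in> T"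
    define k where "k = nat \<lfloor>log 2 (nrm m)\<rfloor>"
    have pos: "nrm m \<ge> 1" using m T nrm_ge_1 by auto
    then have k: "real k \<le> log 2 (nrm m)" "log 2 (nrm m) < real k + 1"
      unfolding k_def using zero_le_log_cancel_iff[of 2 "nrm m"] by linarith+
    have 1: "2 ^ k \<le> nrm m" using k(1) pos by (simp add: le_log_iff powr_realpow)
    have 2: "nrm m < 2 ^ Suc k"
      using k(2) pos by (subst (asm) log_less_iff) (auto simp: powr_add powr_realpow)
    have "2 ^ k < (2::real) ^ K" using 1 K[OF m] by linarith
    then have "k < K" by simp
    have "nrm m powr - s \<le> (2 ^ k) powr - s"
      using 1 s by (intro powr_mono2') auto
    also have "\<dots> = (if 2 ^ k \<le> nrm m \<and> nrm m \<le> 2 ^ Suc k then (2 ^ k) powr - s else 0)"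
      using 1 2 by simp
    also have "\<dots> \<le> (\<Sum>k<K. if 2 ^ k \<le> nrm m \<and> nrm m \<le> 2 ^ Suc k then (2 ^ k) powr - s else 0)"
      using \<open>k < K\<close> by (intro member_le_sum) auto
    finally show "nrm m powr - s \<le> (\<Sum>k<K. if 2 ^ k \<le> nrm m \<and> nrm m \<le> 2 ^ Suc k then (2 ^ k) powr - s else 0)" .
  qed
  also have "\<dots> = (\<Sum>k<K. \<Sum>m\<in>T. if 2 ^ k \<le> nrm m \<and> nrm m \<le> 2 ^ Suc k then (2 ^ k) powr - s else 0)"
    by (rule sum.swap)
  also have "\<dots> \<le> (\<Sum>k<K. 2 * C * r ^ k)"
  proof (intro sum_mono)
    fix k
    have "(\<Sum>m\<in>T. if 2 ^ k \<le> nrm m \<and> nrm m \<le> 2 ^ Suc k then (2 ^ k) powr - s else 0)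
        = real (card {m \<in> T. 2 ^ k \<le> nrm m \<and> nrm m \<le> 2 ^ Suc k}) * (2 ^ k) powr - s"
      using T(1) by (simp add: sum.If_cases Int_def)
    also have "\<dots> \<le> real (card (elems_upto (2 ^ Suc k))) * (2 ^ k) powr - s"
    proof (intro mult_right_mono of_nat_mono card_mono finite_elems_upto)
      show "{m \<in> T. 2 ^ k \<le> nrm m \<and> nrm m \<le> 2 ^ Suc k} \<subseteq> elems_upto (2 ^ Suc k)"
        using T(2) by (auto simp: elems_upto_def)
    qed simp
    also have "\<dots> \<le> (C * 2 ^ Suc k) * (2 ^ k) powr - s"
      by (intro mult_right_mono count_bounds) (simp_all add: one_le_power del: power_Suc)
    also have "(2 ^ k) * (2 ^ k) powr - s = r ^ k"
      by (simp add: r_def powr_realpow[symmetric] powr_powr powr_add[symmetric] algebra_simps)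
    then have "(C * 2 ^ Suc k) * (2 ^ k) powr - s = 2 * C * r ^ k" by simp
    finally show "(\<Sum>m\<in>T. if 2 ^ k \<le> nrm m \<and> nrm m \<le> 2 ^ Suc k then (2 ^ k) powr - s else 0) \<le> 2 * C * r ^ k" .
  qed
  also have "\<dots> = 2 * C * (\<Sum>k<K. r ^ k)" by (simp add: sum_distrib_left)
  also have "\<dots> \<le> 2 * C * (1 / (1 - r))"
  proof (intro mult_left_mono)
    have "(\<Sum>k<K. r ^ k) = (1 - r ^ K) / (1 - r)"
      using r by (simp add: sum_gp_strict)
    also have "\<dots> \<le> 1 / (1 - r)" using r by (intro divide_right_mono) auto
    finally show "(\<Sum>k<K. r ^ k) \<le> 1 / (1 - r)" .
  qed (use C_ge_1 in simp)
  finally show ?thesis by (simp add: r_def)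
qed

lemma N_powr_sum_le:
  assumes "finite Q" "Q \<subseteq> P" "s > 1"
  shows "(\<Sum>p\<in>Q. real (N p) powr - s) \<le> 2 * C / (1 - 2 powr (1 - s))"
proof -
  have "(\<Sum>p\<in>Q. real (N p) powr - s) = (\<Sum>m\<in>(\<lambda>p. {#p#}) ` Q. nrm m powr - s)"
    by (subst sum.reindex) (simp_all add: inj_on_def)
  also have "\<dots> \<le> 2 * C / (1 - 2 powr (1 - s))"
    using assms by (intro nrm_powr_sum_le) (auto simp: free_abelian_monoid_def)
  finally show ?thesis .
qed

lemma N_inverse_square_sum_le:
  assumes "finite Q" "Q \<subseteq> P"
  shows "(\<Sum>p\<in>Q. (1 / real (N p))\<^sup>2) \<le> 4 * C"
proof -
  have "(\<Sum>p\<in>Q. (1 / real (N p))\<^sup>2) = (\<Sum>p\<in>Q. real (N p) powr - 2)"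
    using assms N_gt_1
    by (intro sum.cong refl) (auto simp: powr_minus divide_simps powr_numeral)
  also have "\<dots> \<le> 4 * C"
    using N_powr_sum_le[OF assms, of 2] by (simp add: powr_minus)
  finally show ?thesis .
qed

section \<open>The sum of the reciprocals of the norms of the generators\<close>

text \<open>
  The partial sums of the harmonic series of the monoid grow at least like a logarithm: each block
  between consecutive powers of a large \<open>D\<close> contributes at least \<open>1 / D\<close>.
\<close>

lemma nrm_inverse_sum_ge:
  obtains D where "D > 1" "\<And>K. real K / D \<le> (\<Sum>m\<in>elems_upto (D ^ K). 1 / nrm m)"
proof
  \<comment> \<open>With this ratio, the block from \<open>D ^ K\<close> to \<open>D ^ Suc K\<close> has at least \<open>c * D ^ Suc K - C * D ^ K = D ^ K\<close> elements.\<close>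
  define D where "D = (C + 1) / c"
  show D: "D > 1" using c_le_C c_pos by (simp add: D_def)
  fix K :: nat
  show "real K / D \<le> (\<Sum>m\<in>elems_upto (D ^ K). 1 / nrm m)"
  proof (induction K)
    case 0
    then show ?case by (simp add: sum_nonneg)
  next
    case (Suc K)
    let ?B = "elems_upto (D ^ Suc K) - elems_upto (D ^ K)"
    have sub: "elems_upto (D ^ K) \<subseteq> elems_upto (D ^ Suc K)" using D by (intro elems_upto_mono) simp
    have "D ^ K = c * D ^ Suc K - C * D ^ K"
      using c_pos by (simp add: D_def field_simps)
    also have "\<dots> \<le> real (card (elems_upto (D ^ Suc K))) - real (card (elems_upto (D ^ K)))"
      using D by (intro diff_mono count_bounds) (auto simp: one_le_power simp del: power_Suc)
    also have "\<dots> = real (card ?B)"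
      using sub by (simp add: card_Diff_subset card_mono of_nat_diff)
    finally have card: "D ^ K \<le> real (card ?B)" .
    have "1 / D = D ^ K * (1 / D ^ Suc K)" using D by simp
    also have "\<dots> \<le> real (card ?B) * (1 / D ^ Suc K)"
      using card D by (intro mult_right_mono) auto
    also have "\<dots> = (\<Sum>m\<in>?B. 1 / D ^ Suc K)" by simp
    also have "\<dots> \<le> (\<Sum>m\<in>?B. 1 / nrm m)"
      using D nrm_ge_1 by (intro sum_mono divide_left_mono) (force simp: elems_upto_def)+
    finally have "1 / D \<le> (\<Sum>m\<in>?B. 1 / nrm m)" .
    moreover have "(\<Sum>m\<in>elems_upto (D ^ Suc K). 1 / nrm m) = (\<Sum>m\<in>?B. 1 / nrm m) + (\<Sum>m\<in>elems_upto (D ^ K). 1 / nrm m)"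
      using sub by (intro sum.subset_diff) auto
    ultimately show ?case using Suc.IH by (simp add: add_divide_distrib del: power_Suc)
  qed
qed

text \<open>
  Every element of norm at most \<open>x\<close> is composed of generators of norm at most \<open>x\<close>, so its term occurs
  in the Euler product over these generators; each factor is a geometric series with ratio at most
  one half.
\<close>

lemma nrm_inverse_sum_le:
  "(\<Sum>m\<in>elems_upto x. 1 / nrm m) \<le> exp (recip_sum x + 8 * C)"
proof -
  define Q where "Q = primes_upto x"
  have Q: "finite Q" "Q \<subseteq> P" by (simp_all add: Q_def) (auto simp: primes_upto_def)
  \<comment> \<open>An upper bound for the exponents that occur, as \<open>2 ^ size m \<le> nrm m\<close>.\<close>
  define J where "J = nat \<lceil>x\<rceil>"
  have "(\<Sum>m\<in>elems_upto x. 1 / nrm m) = (\<Sum>m\<in>elems_upto x. nrm m powr - 1)"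
    by (intro sum.cong refl) (simp add: powr_minus divide_inverse powr_one)
  also have "\<dots> \<le> (\<Prod>p\<in>Q. \<Sum>j\<le>J. (real (N p) powr - 1) ^ j)"
  proof (rule Euler_product_le[OF Q(1)])
    fix m assume m: "m \<in> elems_upto x"
    then have mM: "m \<in> free_abelian_monoid P" and mx: "nrm m \<le> x" by (auto simp: elems_upto_def)
    have "set_mset m \<subseteq> Q"
    proof
      fix p assume p: "p \<in># m"
      then obtain m' where m': "m = add_mset p m'" by (metis insert_DiffM)
      then have "p \<in> P" "m' \<in> free_abelian_monoid P"
        using mM by (auto simp: free_abelian_monoid_def)
      moreover have "nrm m = real (N p) * nrm m'" by (simp add: m' norm_ext_prod_mset)
      ultimately have "real (N p) \<le> nrm m" using nrm_ge_1[of m'] by (simp add: mult_le_cancel_left1)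
      with mx \<open>p \<in> P\<close> show "p \<in> Q" by (simp add: Q_def primes_upto_def)
    qed
    moreover have "count m p \<le> J" for p
    proof -
      have "count m p \<le> size m" by (rule count_le_size)
      moreover have "real (size m) < 2 ^ size m" by (rule of_nat_less_two_power)
      ultimately have "real (count m p) \<le> x" using nrm_ge_power_size[OF mM] mx by linarith
      then show ?thesis unfolding J_def by linarith
    qed
    ultimately show "set_mset m \<subseteq> Q \<and> (\<forall>p\<in>Q. count m p \<in> {..J})" by simp
  qed (use Q N_gt_1 in \<open>auto dest!: subsetD intro: less_trans\<close>)
  also have "\<dots> \<le> exp (\<Sum>p\<in>Q. 1 / real (N p) + 2 * (1 / real (N p))\<^sup>2)"
  proof (rule prod_le_exp_sum[OF Q(1)])
    fix p assume "p \<in> Q"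
    then have "real (N p) \<ge> 2" using Q N_ge_2 by auto
    define u where "u = 1 / real (N p)"
    have u: "0 < u" "u \<le> 1 / 2" using \<open>real (N p) \<ge> 2\<close> by (simp_all add: u_def divide_simps)
    have "(\<Sum>j\<le>J. (real (N p) powr - 1) ^ j) = (\<Sum>j\<le>J. u ^ j)"
      by (simp add: u_def powr_minus divide_inverse powr_one)
    also have "\<dots> = (1 - u ^ Suc J) / (1 - u)"
      using u by (simp add: sum_gp_basic sum_gp0)
    also have "\<dots> \<le> 1 / (1 - u)"
      using u by (intro divide_right_mono) auto
    also have "\<dots> = exp (- ln (1 - u))"
      using u by (simp add: exp_minus inverse_eq_divide)
    also have "\<dots> \<le> exp (u + 2 * u\<^sup>2)"
      using ln_one_minus_pos_lower_bound[of u] u by simp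
    finally show "(\<Sum>j\<le>J. (real (N p) powr - 1) ^ j) \<le> exp (1 / real (N p) + 2 * (1 / real (N p))\<^sup>2)"
      by (simp add: u_def)
  qed (simp add: sum_nonneg)
  also have "(\<Sum>p\<in>Q. 1 / real (N p) + 2 * (1 / real (N p))\<^sup>2) = recip_sum x + 2 * (\<Sum>p\<in>Q. (1 / real (N p))\<^sup>2)"
    by (simp add: sum.distrib sum_distrib_left recip_sum_def Q_def)
  also have "exp \<dots> \<le> exp (recip_sum x + 8 * C)"
    using N_inverse_square_sum_le[OF Q] by simp
  finally show ?thesis .
qed

text \<open>
  Euler's argument for the divergence of the sum of the reciprocals of the primes: compare the two
  estimates for the harmonic sum.
\<close>

lemma recip_sum_ge:
  obtains k where "eventually (\<lambda>x. ln (ln x) - k \<le> recip_sum x) at_top"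
proof -
  obtain D where D: "D > 1" and *: "\<And>K. real K / D \<le> (\<Sum>m\<in>elems_upto (D ^ K). 1 / nrm m)"
    using nrm_inverse_sum_ge by blast
  define k where "k = ln (2 * D * ln D) + 8 * C"
  have "ln (ln x) - k \<le> recip_sum x" if x: "x \<ge> D\<^sup>2" for x
  proof -
    have "D\<^sup>2 > 1" using D by simp
    with x have "x > 1" by linarith
    define K where "K = nat \<lfloor>log D x\<rfloor>"
    have "log D x \<ge> 2" using x D \<open>x > 1\<close> by (simp add: le_log_iff)
    then have K: "real K \<le> log D x" "log D x / 2 \<le> real K"
      unfolding K_def by linarith+
    have "D ^ K \<le> x" using K(1) \<open>x > 1\<close> D by (simp add: le_log_iff powr_realpow)
    have "ln x / (2 * D * ln D) = (log D x / 2) / D" by (simp add: log_def)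
    also have "\<dots> \<le> real K / D" using K D by (intro divide_right_mono) auto
    also have "\<dots> \<le> (\<Sum>m\<in>elems_upto (D ^ K). 1 / nrm m)" by (rule *)
    also have "\<dots> \<le> (\<Sum>m\<in>elems_upto x. 1 / nrm m)"
      using \<open>D ^ K \<le> x\<close> by (intro sum_mono2 elems_upto_mono) auto
    also have "\<dots> \<le> exp (recip_sum x + 8 * C)" by (rule nrm_inverse_sum_le)
    finally have "ln (ln x / (2 * D * ln D)) \<le> ln (exp (recip_sum x + 8 * C))"
      using \<open>x > 1\<close> D by (subst ln_le_cancel_iff) auto
    then show ?thesis using \<open>x > 1\<close> D by (simp add: ln_div k_def)
  qed
  then show thesis by (intro that eventually_mono[OF eventually_ge_at_top[of "D\<^sup>2"]])
qed

text \<open>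
  Rankin's trick. The generators up to \<open>x\<close> are finite in number, but their squarefree combinations have
  unbounded norm; moving the exponent from \<open>1\<close> to \<open>1 + \<delta> / ln x\<close> makes the sum over them at most of
  order \<open>ln x\<close> and costs each term with \<open>N p \<le> x\<close> only a factor \<open>exp \<delta>\<close>.
\<close>

lemma recip_sum_le:
  assumes \<delta>: "0 < \<delta>" "\<delta> \<le> 1" and x: "x \<ge> exp 1"
  shows "recip_sum x \<le> exp \<delta> * (ln (ln x) + ln (8 * C / \<delta>) + 4 * C)"
proof -
  define Q where "Q = primes_upto x"
  have Q: "finite Q" "Q \<subseteq> P" by (simp_all add: Q_def) (auto simp: primes_upto_def)
  have xpos: "x > 0" using x exp_gt_zero[of "1::real"] by linarith
  have lnx: "ln x \<ge> 1" using x xpos by (simp add: ln_ge_iff)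
  define t where "t = \<delta> / ln x"
  have t: "0 < t" "t \<le> 1" using \<delta> lnx by (auto simp: t_def divide_simps)
  define v where "v = (\<lambda>p. real (N p) powr - (1 + t))"
  have vpos: "0 < v p" if "p \<in> Q" for p using that Q N_ge_2[of p] by (auto simp: v_def)
  have v_le: "v p \<le> 1 / real (N p)" if "p \<in> Q" for p
  proof -
    have "v p \<le> real (N p) powr - 1"
      unfolding v_def using that Q N_ge_2[of p] t by (intro powr_mono) auto
    then show ?thesis by (simp add: powr_minus divide_inverse powr_one)
  qed
  have v_ge: "exp (- \<delta>) * (1 / real (N p)) \<le> v p" if "p \<in> Q" for p
  proof -
    have Np: "real (N p) \<ge> 2" "real (N p) \<le> x"
      using that Q N_ge_2[of p] by (auto simp: Q_def primes_upto_def)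
    have "exp (- \<delta>) = x powr - t" using xpos lnx by (auto simp: powr_def t_def)
    also have "\<dots> \<le> real (N p) powr - t" using Np t by (intro powr_mono2') auto
    finally have "exp (- \<delta>) * (1 / real (N p)) \<le> real (N p) powr - t * (1 / real (N p))"
      by (intro mult_right_mono) auto
    also have "\<dots> = v p" using Np by (simp add: v_def powr_diff powr_minus field_simps)
    finally show ?thesis .
  qed
  have "exp (\<Sum>p\<in>Q. ln (1 + v p)) = (\<Prod>p\<in>Q. 1 + v p)"
    using vpos Q by (simp add: exp_sum) (intro prod.cong refl exp_ln, force)
  also have "\<dots> = (\<Sum>m\<in>mset_set ` Pow Q. nrm m powr - (1 + t))"
    unfolding v_def using Q N_gt_1 by (intro squarefree_Euler_product) (auto dest!: subsetD intro: less_trans)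
  also have "\<dots> \<le> 2 * C / (1 - 2 powr (1 - (1 + t)))"
  proof (rule nrm_powr_sum_le)
    show "mset_set ` Pow Q \<subseteq> free_abelian_monoid P"
    proof (safe, goal_cases)
      case (1 _ S)
      then have "finite S" using Q finite_subset by blast
      with 1 Q show ?case by (auto simp: free_abelian_monoid_def)
    qed
  qed (use Q t in auto)
  also have "\<dots> \<le> 2 * C / (t / 4)"
  proof (intro divide_left_mono)
    define u where "u = t * ln 2"
    have ln2: "1 / 2 \<le> ln (2::real)" "ln (2::real) \<le> 1"
      using ln_le_minus_one[of "1 / 2"] ln_le_minus_one[of 2] by (simp_all add: ln_div)
    have "t * (1 / 2) \<le> u" "u \<le> 1"
      unfolding u_def using t ln2 by (intro mult_left_mono mult_le_one; simp)+
    then have u: "t / 2 \<le> u" "u \<le> 1" by simp_all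
    have "(2::real) powr (1 - (1 + t)) = exp (- u)" by (simp add: powr_def u_def)
    also have "\<dots> = 1 / exp u" by (simp add: exp_minus inverse_eq_divide)
    also have "\<dots> \<le> 1 / (1 + u)" using t u by (intro divide_left_mono exp_ge_add_one_self) auto
    also have "\<dots> \<le> 1 - u / 2"
      using t u by (simp add: divide_simps) (simp add: algebra_simps mult_le_one)
    finally show "t / 4 \<le> 1 - (2::real) powr (1 - (1 + t))" using u by simp
  qed (use t C_ge_1 in \<open>auto simp: powr_less_one intro!: mult_pos_pos\<close>)
  also have "\<dots> = ln x * (8 * C / \<delta>)" using \<delta> lnx by (simp add: t_def field_simps)
  also have "\<dots> = exp (ln (ln x) + ln (8 * C / \<delta>))" using \<delta> lnx C_ge_1 by (simp add: exp_add)
  finally have *: "(\<Sum>p\<in>Q. ln (1 + v p)) \<le> ln (ln x) + ln (8 * C / \<delta>)" by simp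
  have "exp (- \<delta>) * recip_sum x = (\<Sum>p\<in>Q. exp (- \<delta>) * (1 / real (N p)))"
    by (simp add: recip_sum_def Q_def sum_distrib_left)
  also have "\<dots> \<le> (\<Sum>p\<in>Q. ln (1 + v p) + (1 / real (N p))\<^sup>2)"
  proof (intro sum_mono)
    fix p assume p: "p \<in> Q"
    have "1 / real (N p) \<le> 1" using p Q N_ge_2[of p] by (auto simp: divide_simps)
    then have "v p - (v p)\<^sup>2 \<le> ln (1 + v p)"
      using vpos[OF p] v_le[OF p] by (intro ln_one_plus_pos_lower_bound) auto
    moreover have "(v p)\<^sup>2 \<le> (1 / real (N p))\<^sup>2"
      using vpos[OF p] v_le[OF p] by (intro power_mono) auto
    ultimately show "exp (- \<delta>) * (1 / real (N p)) \<le> ln (1 + v p) + (1 / real (N p))\<^sup>2"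
      using v_ge[OF p] by linarith
  qed
  also have "\<dots> \<le> ln (ln x) + ln (8 * C / \<delta>) + 4 * C"
    using * N_inverse_square_sum_le[OF Q] by (simp add: sum.distrib)
  finally show ?thesis by (simp add: exp_minus field_simps)
qed

text \<open>
  A weak form of Mertens' second theorem, with an error \<open>o(ln (ln x))\<close> in place of \<open>O(1)\<close>. The
  factor \<open>exp \<delta>\<close> in the upper bound can be taken as close to \<open>1\<close> as desired.
\<close>

lemma recip_sum_asymp:
  assumes "\<eta> > 0"
  shows "eventually (\<lambda>x. \<bar>recip_sum x - ln (ln x)\<bar> \<le> \<eta> * ln (ln x)) at_top"
proof -
  obtain k where k: "eventually (\<lambda>x. ln (ln x) - k \<le> recip_sum x) at_top"
    using recip_sum_ge by blast
  define \<delta> where "\<delta> = min 1 (ln (1 + \<eta> / 2))"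
  have \<delta>: "0 < \<delta>" "\<delta> \<le> 1" using assms by (auto simp: \<delta>_def)
  have "exp \<delta> \<le> exp (ln (1 + \<eta> / 2))" by (simp add: \<delta>_def)
  then have e: "exp \<delta> \<le> 1 + \<eta> / 2" using assms by simp
  define l where "l = \<bar>ln (8 * C / \<delta>) + 4 * C\<bar>"
  have "eventually (\<lambda>x::real. max (\<bar>k\<bar> / \<eta>) (2 * (1 + \<eta> / 2) * l / \<eta>) \<le> ln (ln x)) at_top"
    by (rule eventually_lnln_ge)
  with k eventually_ge_at_top[of "exp 1"] show ?thesis
  proof eventually_elim
    case (elim x)
    then have 1: "\<bar>k\<bar> \<le> \<eta> * ln (ln x)" and 2: "(1 + \<eta> / 2) * l \<le> \<eta> / 2 * ln (ln x)"
      using assms by (auto simp: field_simps)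
    have "ln (ln x) \<ge> 0" using 1 assms by (smt (verit) zero_le_mult_iff)
    have "recip_sum x \<le> exp \<delta> * (ln (ln x) + ln (8 * C / \<delta>) + 4 * C)"
      using recip_sum_le[OF \<delta>] elim by blast
    also have "\<dots> \<le> exp \<delta> * (ln (ln x) + l)" by (intro mult_left_mono) (auto simp: l_def)
    also have "\<dots> \<le> (1 + \<eta> / 2) * (ln (ln x) + l)"
      using e \<open>ln (ln x) \<ge> 0\<close> by (intro mult_right_mono) (auto simp: l_def)
    also have "\<dots> = ln (ln x) + \<eta> / 2 * ln (ln x) + (1 + \<eta> / 2) * l" by (simp add: algebra_simps)
    also have "\<dots> \<le> ln (ln x) + \<eta> * ln (ln x)" using 2 by simp
    finally show ?case using 1 elim by linarith
  qed
qed

section \<open>The variance of the number of prime divisors\<close>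

lemma card_multiples:
  assumes "d \<in> free_abelian_monoid P"
  shows "card {m \<in> elems_upto x. d \<subseteq># m} = card (elems_upto (x / nrm d))"
proof -
  have pos: "nrm d > 0" using nrm_ge_1[OF assms] by linarith
  have "bij_betw (\<lambda>m. m + d) (elems_upto (x / nrm d)) {m \<in> elems_upto x. d \<subseteq># m}"
  proof (rule bij_betw_byWitness[where f' = "\<lambda>m. m - d"])
    show "(\<lambda>m. m + d) ` elems_upto (x / nrm d) \<subseteq> {m \<in> elems_upto x. d \<subseteq># m}"
      using assms pos by (auto simp: elems_upto_def free_abelian_monoid_def norm_ext_add field_simps)
    show "(\<lambda>m. m - d) ` {m \<in> elems_upto x. d \<subseteq># m} \<subseteq> elems_upto (x / nrm d)"
    proof safe
      fix m assume m: "m \<in> elems_upto x" "d \<subseteq># m"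
      then obtain e where "m = d + e" by (metis subset_mset.add_diff_inverse)
      then show "m - d \<in> elems_upto (x / nrm d)"
        using m pos by (auto simp: elems_upto_def free_abelian_monoid_def norm_ext_add field_simps)
    qed
  qed (auto simp: subset_mset.diff_add)
  from bij_betw_same_card[OF this] show ?thesis by simp
qed

text \<open>
  The multiples of \<open>d\<close> up to \<open>x\<close> correspond to the elements up to \<open>x / nrm d\<close>, which is again a
  point of \<open>X\<close>.
\<close>

lemma card_multiples_asymp:
  assumes "d \<in> free_abelian_monoid P" "x \<in> X" "nrm d \<le> x"
  shows "\<bar>real (card {m \<in> elems_upto x. d \<subseteq># m}) - \<kappa> * x / nrm d\<bar> \<le> C * x powr \<theta>"
proof -
  have d: "nrm d \<ge> 1" by (rule nrm_ge_1[OF assms(1)])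
  have "\<bar>real (card (elems_upto (x / nrm d))) - \<kappa> * (x / nrm d)\<bar> \<le> C * (x / nrm d) powr \<theta>"
    using count_asymp[OF X_divide[OF assms(2,1)]] assms(3) d by (simp add: elems_upto_def)
  also have "\<dots> \<le> C * x powr \<theta>"
    using assms(3) d \<theta>_nonneg C_ge_1
    by (intro mult_left_mono powr_mono2) (auto simp: divide_le_eq mult_le_cancel_left1)
  finally show ?thesis by (simp add: card_multiples[OF assms(1)])
qed

definition omega_upto :: "real \<Rightarrow> 'p multiset \<Rightarrow> real" where
  "omega_upto z m = (\<Sum>p\<in>primes_upto z. if p \<in># m then 1 else 0)"

lemma recip_sum_nonneg: "0 \<le> recip_sum z"
  by (simp add: recip_sum_def sum_nonneg)

lemma recip_sum_le_card: "recip_sum z \<le> real (card (primes_upto z))"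
proof -
  have "recip_sum z \<le> (\<Sum>p\<in>primes_upto z. 1)"
    unfolding recip_sum_def
    using N_ge_2 by (intro sum_mono) (force simp: primes_upto_def divide_simps)
  then show ?thesis by simp
qed

text \<open>
  Turan's variance computation. The first two moments of \<open>omega_upto z\<close> are sums, over generators and over
  pairs of generators, of numbers of multiples. The main terms \<open>\<kappa> * x * L\<^sup>2\<close>, with \<open>L = recip_sum z\<close>,
  cancel in the variance, and the diagonal pairs leave \<open>\<kappa> * x * L\<close>. There are at most \<open>(C * z)\<^sup>2\<close> error
  terms, each at most \<open>C * x powr \<theta>\<close>, which explains the condition on \<open>z\<close>.
\<close>

lemma Turan_second_moment:
  assumes x: "x \<in> X" "x \<ge> 1" and z: "z \<ge> 1" "x powr \<theta> * z\<^sup>2 \<le> x"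
  shows "(\<Sum>m\<in>elems_upto x. (omega_upto z m - recip_sum z)\<^sup>2) \<le> \<kappa> * x * recip_sum z + 5 * C ^ 3 * x"
proof -
  define Q where "Q = primes_upto z"
  define L where "L = recip_sum z"
  define E where "E = C * x powr \<theta>"
  define q where "q = real (card Q)"
  have Q: "finite Q" and QP: "\<And>p. p \<in> Q \<Longrightarrow> p \<in> P \<and> real (N p) \<le> z"
    by (simp_all add: Q_def) (auto simp: primes_upto_def)
  have L: "0 \<le> L" "L \<le> q" "L = (\<Sum>p\<in>Q. 1 / real (N p))"
    by (simp_all add: L_def q_def Q_def recip_sum_nonneg recip_sum_le_card)
      (simp add: recip_sum_def)
  have E: "E \<ge> 0" using C_ge_1 by (simp add: E_def)
  have zx: "z\<^sup>2 \<le> x"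
  proof -
    have "1 * z\<^sup>2 \<le> x powr \<theta> * z\<^sup>2"
      using x \<theta>_nonneg by (intro mult_right_mono ge_one_powr_ge_zero) auto
    with z(2) show ?thesis by linarith
  qed
  have "z * 1 \<le> z * z" using z by (intro mult_left_mono) auto
  then have zx': "z \<le> x" using zx by (simp add: power2_eq_square)
  define F :: "'p \<Rightarrow> 'p multiset \<Rightarrow> real" where "F = (\<lambda>p m. if p \<in># m then 1 else (0::real))"
  have om: "omega_upto z m = (\<Sum>p\<in>Q. F p m)" for m by (simp add: omega_upto_def Q_def F_def)
  have single: "\<bar>(\<Sum>m\<in>elems_upto x. F p m) - \<kappa> * x * (1 / real (N p))\<bar> \<le> E" if "p \<in> Q" for p
  proof -
    have "(\<Sum>m\<in>elems_upto x. F p m) = real (card {m \<in> elems_upto x. {#p#} \<subseteq># m})"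
      by (simp add: F_def sum.If_cases Int_def)
    then show ?thesis
      using card_multiples_asymp[of "{#p#}" x] QP[OF that] zx' x
      by (simp add: E_def free_abelian_monoid_def)
  qed
  have pair: "(\<Sum>m\<in>elems_upto x. F p m * F p' m) \<le> \<kappa> * x * (1 / real (N p)) * (1 / real (N p')) + E
      + (if p = p' then \<kappa> * x * (1 / real (N p)) + E else 0)"
    if p: "p \<in> Q" "p' \<in> Q" for p p'
  proof (cases "p = p'")
    case True
    have "(\<Sum>m\<in>elems_upto x. F p m * F p' m) = (\<Sum>m\<in>elems_upto x. F p m)"
      using True by (intro sum.cong refl) (simp add: F_def)
    also have "\<dots> \<le> \<kappa> * x * (1 / real (N p)) + E" using single[OF p(1)] by linarith
    moreover have "0 \<le> \<kappa> * x * (1 / real (N p)) * (1 / real (N p'))"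
      using \<kappa>_pos x by simp
    ultimately show ?thesis using True E by simp
  next
    case False
    have "N p * N p' \<le> z * z" using QP[OF p(1)] QP[OF p(2)] z by (simp add: mult_mono)
    then have le: "real (N p) * real (N p') \<le> x" using zx by (simp add: power2_eq_square)
    have "(\<Sum>m\<in>elems_upto x. F p m * F p' m) = (\<Sum>m\<in>elems_upto x. if {#p, p'#} \<subseteq># m then 1 else 0)"
      using False by (intro sum.cong refl) (auto simp: F_def insert_subset_eq_iff in_diff_count split: if_splits)
    also have "\<dots> = real (card {m \<in> elems_upto x. {#p, p'#} \<subseteq># m})"
      by (simp add: sum.If_cases Int_def)
    finally show ?thesis
      using False card_multiples_asymp[of "{#p, p'#}" x] QP[OF p(1)] QP[OF p(2)] le x
      by (simp add: E_def free_abelian_monoid_def norm_ext_prod_mset)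
  qed
  define S1 where "S1 = (\<Sum>m\<in>elems_upto x. omega_upto z m)"
  define S2 where "S2 = (\<Sum>m\<in>elems_upto x. (omega_upto z m)\<^sup>2)"
  have S0: "real (card (elems_upto x)) \<le> \<kappa> * x + E"
    using count_asymp[OF x] by (simp add: E_def elems_upto_def)
  have S1: "\<kappa> * x * L - E * q \<le> S1"
  proof -
    have "\<kappa> * x * L - E * q = (\<Sum>p\<in>Q. \<kappa> * x * (1 / real (N p)) - E)"
      by (simp add: L(3) q_def sum_subtractf sum_distrib_left)
    also have "\<dots> \<le> (\<Sum>p\<in>Q. \<Sum>m\<in>elems_upto x. F p m)"
      by (intro sum_mono) (use single in force)
    also have "\<dots> = S1" unfolding S1_def om by (rule sum.swap)
    finally show ?thesis .
  qed
  have S2: "S2 \<le> \<kappa> * x * L\<^sup>2 + \<kappa> * x * L + E * (q\<^sup>2 + q)"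
  proof -
    have "S2 = (\<Sum>m\<in>elems_upto x. \<Sum>p\<in>Q. \<Sum>p'\<in>Q. F p m * F p' m)"
      unfolding S2_def om by (simp add: power2_eq_square sum_product)
    also have "\<dots> = (\<Sum>p\<in>Q. \<Sum>m\<in>elems_upto x. \<Sum>p'\<in>Q. F p m * F p' m)" by (rule sum.swap)
    also have "\<dots> = (\<Sum>p\<in>Q. \<Sum>p'\<in>Q. \<Sum>m\<in>elems_upto x. F p m * F p' m)"
      by (intro sum.cong refl sum.swap)
    also have "\<dots> \<le> (\<Sum>p\<in>Q. \<Sum>p'\<in>Q. \<kappa> * x * (1 / real (N p)) * (1 / real (N p')) + E
      + (if p = p' then \<kappa> * x * (1 / real (N p)) + E else 0))"
      by (intro sum_mono pair)
    also have "\<dots> = \<kappa> * x * L\<^sup>2 + E * q\<^sup>2 + (\<kappa> * x * L + E * q)"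
    proof -
      have "(\<Sum>p\<in>Q. \<Sum>p'\<in>Q. \<kappa> * x * (1 / real (N p)) * (1 / real (N p'))) = \<kappa> * x * L\<^sup>2"
        by (simp only: sum_distrib_left[symmetric] sum_distrib_right[symmetric] L(3) power2_eq_square mult.assoc)
      moreover have "(\<Sum>p\<in>Q. \<Sum>p'\<in>Q. if p = p' then \<kappa> * x * (1 / real (N p)) + E else 0) = \<kappa> * x * L + E * q"
        using Q by (simp add: L(3) q_def sum.distrib sum_distrib_left)
      moreover have "(\<Sum>p\<in>Q. \<Sum>p'\<in>Q. E) = E * q\<^sup>2" by (simp add: q_def power2_eq_square)
      ultimately show ?thesis by (simp only: sum.distrib)
    qed
    finally show ?thesis by (simp add: algebra_simps)
  qed
  have qq: "q \<le> q\<^sup>2" by (simp add: q_def power2_eq_square) (metis le_square of_nat_le_iff of_nat_mult)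
  have "q \<le> C * z"
    using card_primes_upto[of z] count_bounds(2)[OF z(1)] by (simp add: q_def Q_def)
  then have "q\<^sup>2 \<le> C\<^sup>2 * z\<^sup>2" unfolding power_mult_distrib[symmetric]
    by (intro power_mono) (simp_all add: q_def)
  then have "E * q\<^sup>2 \<le> E * (C\<^sup>2 * z\<^sup>2)" using E by (intro mult_left_mono)
  also have "\<dots> = C ^ 3 * (x powr \<theta> * z\<^sup>2)" by (simp add: E_def eval_nat_numeral)
  also have "\<dots> \<le> C ^ 3 * x" using z C_ge_1 by (intro mult_left_mono) auto
  finally have Eq: "E * q\<^sup>2 \<le> C ^ 3 * x" .
  have "(\<Sum>m\<in>elems_upto x. (omega_upto z m - L)\<^sup>2) = S2 - 2 * L * S1 + L\<^sup>2 * real (card (elems_upto x))"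
    by (simp add: S1_def S2_def power2_diff sum.distrib sum_subtractf sum_distrib_left algebra_simps)
  also have "\<dots> \<le> (\<kappa> * x * L\<^sup>2 + \<kappa> * x * L + E * (q\<^sup>2 + q)) - 2 * L * (\<kappa> * x * L - E * q) + L\<^sup>2 * (\<kappa> * x + E)"
    using S0 S1 S2 L(1) by (intro add_mono diff_mono mult_left_mono) auto
  also have "\<dots> = \<kappa> * x * L + E * (q\<^sup>2 + q + 2 * L * q + L\<^sup>2)"
    by (simp add: algebra_simps power2_eq_square)
  also have "\<dots> \<le> \<kappa> * x * L + E * (q\<^sup>2 + q\<^sup>2 + 2 * q * q + q\<^sup>2)"
    using L(1,2) E qq
    by (intro add_left_mono mult_left_mono add_mono power_mono mult_right_mono order_refl) (auto simp: q_def)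
  also have "\<dots> = \<kappa> * x * L + 5 * (E * q\<^sup>2)" by (simp add: power2_eq_square algebra_simps)
  also have "\<dots> \<le> \<kappa> * x * L + 5 * C ^ 3 * x" using Eq by simp
  finally show ?thesis by (simp add: L_def)
qed

text \<open>
  The product of the generators of norm above \<open>x powr \<delta>\<close> that divide \<open>m\<close> has norm at most \<open>x\<close>, so there
  are at most \<open>1 / \<delta>\<close> of them.
\<close>

lemma omega_minus_omega_upto:
  assumes m: "m \<in> elems_upto x" and x: "x > 1" and \<delta>: "\<delta> > 0"
  shows "omega_upto (x powr \<delta>) m \<le> real (omega m)"
    "real (omega m) \<le> omega_upto (x powr \<delta>) m + 1 / \<delta>"
proof -
  define z where "z = x powr \<delta>"
  have mM: "set_mset m \<subseteq> P" and mx: "nrm m \<le> x"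
    using m by (auto simp: elems_upto_def free_abelian_monoid_def)
  define A where "A = {p \<in> set_mset m. real (N p) \<le> z}"
  define B where "B = {p \<in> set_mset m. real (N p) > z}"
  have fin: "finite A" "finite B" by (auto simp: A_def B_def)
  have "set_mset m = A \<union> B" "A \<inter> B = {}" by (auto simp: A_def B_def)
  then have om: "omega m = card A + card B"
    using fin by (simp add: omega_eq_card_set_mset card_Un_disjoint)
  have "{p \<in> primes_upto z. p \<in># m} = A"
    using mM by (auto simp: A_def primes_upto_def)
  then have omz: "omega_upto z m = real (card A)"
    by (simp add: omega_upto_def sum.If_cases Int_def)
  have z1: "z > 1" using x \<delta> by (simp add: z_def)
  have "x powr (\<delta> * real (card B)) = (\<Prod>p\<in>B. z)"
    using x by (simp add: z_def powr_powr [symmetric] powr_realpow)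
  also have "\<dots> \<le> (\<Prod>p\<in>B. real (N p) ^ count m p)"
  proof (rule prod_mono, safe)
    fix p assume p: "p \<in> B"
    then have "z \<le> real (N p)" "count m p > 0" by (auto simp: B_def)
    then have "real (N p) ^ 1 \<le> real (N p) ^ count m p" using z1 by (intro power_increasing) auto
    then show "z \<le> real (N p) ^ count m p"
      by (intro order_trans[OF \<open>z \<le> real (N p)\<close>]) (simp only: power_one_right)
  qed (use z1 in simp)
  also have "\<dots> \<le> (\<Prod>p\<in>set_mset m. real (N p) ^ count m p)"
    using mM N_ge_2 by (intro prod_mono2) (auto simp: B_def intro!: one_le_power dest!: subsetD; force)+
  also have "\<dots> = nrm m" by (simp add: norm_ext_def)
  also have "\<dots> \<le> x powr 1" using mx x by simp
  finally have "\<delta> * real (card B) \<le> 1" using x by (simp only: powr_le_cancel_iff)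
  then have "real (card B) \<le> 1 / \<delta>" using \<delta> by (simp add: field_simps)
  then show "omega_upto (x powr \<delta>) m \<le> real (omega m)"
    "real (omega m) \<le> omega_upto (x powr \<delta>) m + 1 / \<delta>"
    unfolding z_def[symmetric] by (simp_all add: om omz)
qed

text \<open>
  Chebyshev's inequality for the variance of the truncated function. With \<open>u = ln (ln y)\<close> the variance
  is of order \<open>y * u\<close>, whereas each exceptional element contributes at least a multiple of \<open>u\<^sup>2\<close>.
  Truncation, rounding down \<open>y\<close> to a point of \<open>X\<close>, and replacing the mean value \<open>recip_sum z\<close> by \<open>u\<close>
  change the deviation by at most \<open>\<epsilon> * u / 2\<close>.
\<close>

lemma normal_order:
  assumes \<epsilon>: "\<epsilon> > 0" and \<eta>: "\<eta> > 0"
  shows "eventually (\<lambda>y. real (card {a \<in> elems_upto y. \<epsilon> * ln (ln y) < \<bar>real (omega a) - ln (ln y)\<bar>}) \<le> \<eta> * y) at_top"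
proof -
  \<comment> \<open>The largest exponent for which \<open>z = x powr \<delta>\<close> satisfies \<open>x powr \<theta> * z\<^sup>2 \<le> x\<close>.\<close>
  define \<delta> where "\<delta> = (1 - \<theta>) / 2"
  have \<delta>: "0 < \<delta>" using \<theta>_less_1 by (simp add: \<delta>_def)
  have "eventually (\<lambda>z. \<bar>recip_sum z - ln (ln z)\<bar> \<le> \<epsilon> / 4 * ln (ln z)) at_top"
    using \<epsilon> by (intro recip_sum_asymp) simp
  then obtain z0 where z0: "\<And>z. z \<ge> z0 \<Longrightarrow> \<bar>recip_sum z - ln (ln z)\<bar> \<le> \<epsilon> / 4 * ln (ln z)"
    by (auto simp: eventually_at_top_linorder)
  define z1 where "z1 = max z0 1"
  \<comment> \<open>\<open>k\<close> bounds the change of the iterated logarithm from \<open>y\<close> to \<open>z\<close>; \<open>l\<close> is the constant in the variance bound.\<close>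
  define k where "k = \<bar>ln \<delta>\<bar> + ln 2"
  define l where "l = \<kappa> * (1 + \<epsilon>) + 5 * C ^ 3"
  have k0: "k \<ge> 0" and l0: "l \<ge> 0"
    using \<epsilon> \<kappa>_pos C_ge_1 by (auto simp: k_def l_def)
  show ?thesis
    using eventually_ge_at_top[of "exp 1"] eventually_ge_at_top[of "(C / c)\<^sup>2"]
      eventually_ge_at_top[of "C / c * z1 powr (1 / \<delta>)"]
      eventually_lnln_ge[of 1] eventually_lnln_ge[of "(1 / \<delta> + \<epsilon> / 4 * k + k) / (\<epsilon> / 4)"]
      eventually_lnln_ge[of "4 * l / (\<eta> * \<epsilon>\<^sup>2)"]
  proof eventually_elim
    case (elim y)
    define u where "u = ln (ln y)"
    have u1: "u \<ge> 1" and u2: "1 / \<delta> + \<epsilon> / 4 * k + k \<le> \<epsilon> / 4 * u" and u3: "4 * l \<le> \<eta> * \<epsilon>\<^sup>2 * u"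
      using elim \<epsilon> \<eta> by (auto simp: u_def field_simps)
    have y: "y > 1" using elim(1) exp_ge_add_one_self[of 1] by linarith
    have "ln (exp 1) \<le> ln y" using elim(1) y by (subst ln_le_cancel_iff) auto
    then have lny: "ln y \<ge> 1" by simp
    obtain x where x: "x \<in> X" "1 \<le> x" "x \<le> y" "c / C * y \<le> x" "elems_upto y = elems_upto x"
      using round_down[of y] y by auto
    have cC: "c / C > 0" using c_pos C_ge_1 by simp
    \<comment> \<open>The rounded point \<open>x\<close> is at least \<open>sqrt y\<close>.\<close>
    have "y = (c / C)\<^sup>2 * (C / c)\<^sup>2 * y" using c_pos C_ge_1 by (simp add: field_simps)
    also have "\<dots> \<le> (c / C)\<^sup>2 * y * y" using elim(2) y by (simp add: mult_left_mono mult_right_mono)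
    also have "\<dots> = (c / C * y)\<^sup>2" by (simp add: power2_eq_square)
    also have "\<dots> \<le> x\<^sup>2"
      by (rule power_mono[OF x(4)]) (use cC y c_pos C_ge_1 in simp)
    finally have "ln y \<le> ln (x\<^sup>2)" using y x by (subst ln_le_cancel_iff) auto
    then have lnx: "ln y / 2 \<le> ln x" "ln x \<le> ln y" using x y by (simp_all add: ln_realpow)
    then have lnx_pos: "ln x > 0" using lny by linarith
    then have "x > 1" using x(2) by (cases "x = 1") auto
    have "ln (ln y / 2) \<le> ln (ln x)" "ln (ln x) \<le> ln (ln y)"
      using lnx lny by (auto intro: ln_mono)
    then have lnlnx: "u - ln 2 \<le> ln (ln x)" "ln (ln x) \<le> u"
      using lny by (simp_all add: u_def ln_div)
    define z where "z = x powr \<delta>"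
    have "z1 powr (1 / \<delta>) = c / C * (C / c * z1 powr (1 / \<delta>))" using c_pos C_ge_1 by simp
    also have "\<dots> \<le> c / C * y" using elim(3) cC by (intro mult_left_mono) auto
    also have "\<dots> \<le> x" by (rule x)
    finally have "(z1 powr (1 / \<delta>)) powr \<delta> \<le> z"
      unfolding z_def using \<delta> by (intro powr_mono2) auto
    moreover have "(z1 powr (1 / \<delta>)) powr \<delta> = z1" using \<delta> by (simp add: powr_powr z1_def)
    ultimately have z: "z \<ge> z0" "z \<ge> 1" by (auto simp: z1_def)
    have "ln (ln z) = ln \<delta> + ln (ln x)"
      using \<delta> lnx_pos x by (simp add: z_def ln_powr ln_mult)
    then have lnlnz: "\<bar>ln (ln z) - u\<bar> \<le> k" using lnlnx by (simp add: k_def)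
    have "\<epsilon> / 4 * ln (ln z) \<le> \<epsilon> / 4 * (u + k)" using lnlnz \<epsilon> by (intro mult_left_mono) auto
    also have "\<dots> = \<epsilon> / 4 * u + \<epsilon> / 4 * k" by (simp add: algebra_simps)
    finally have L: "\<bar>recip_sum z - u\<bar> \<le> \<epsilon> / 4 * u + \<epsilon> / 4 * k + k"
      using z0[OF z(1)] lnlnz by linarith
    have "1 / \<delta> > 0" "\<epsilon> * u > 0" using \<delta> \<epsilon> u1 by simp_all
    moreover have "(1 + \<epsilon>) * u = u + \<epsilon> * u" by (simp add: algebra_simps)
    ultimately have L_le: "recip_sum z \<le> (1 + \<epsilon>) * u"
      using L u2 by linarith
    define B where "B = {a \<in> elems_upto x. \<epsilon> * u < \<bar>real (omega a) - u\<bar>}"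
    have B: "finite B" "B \<subseteq> elems_upto x" by (auto simp: B_def)
    have "real (card B) * (\<epsilon> / 2 * u)\<^sup>2 = (\<Sum>a\<in>B. (\<epsilon> / 2 * u)\<^sup>2)" by simp
    also have "\<dots> \<le> (\<Sum>a\<in>B. (omega_upto z a - recip_sum z)\<^sup>2)"
    proof (rule sum_mono)
      fix a assume a: "a \<in> B"
      have "omega_upto z a \<le> real (omega a)" "real (omega a) \<le> omega_upto z a + 1 / \<delta>"
        using omega_minus_omega_upto[of a x \<delta>] a B \<open>x > 1\<close> \<delta> by (auto simp: z_def)
      moreover have "\<epsilon> * u < \<bar>real (omega a) - u\<bar>" using a by (simp add: B_def)
      ultimately have "\<epsilon> / 2 * u \<le> \<bar>omega_upto z a - recip_sum z\<bar>"
        using L u2 by linarith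
      then show "(\<epsilon> / 2 * u)\<^sup>2 \<le> (omega_upto z a - recip_sum z)\<^sup>2"
        using \<epsilon> u1 by (intro abs_le_square_iff[THEN iffD1]) simp
    qed
    also have "\<dots> \<le> (\<Sum>a\<in>elems_upto x. (omega_upto z a - recip_sum z)\<^sup>2)"
      using B by (intro sum_mono2) auto
    also have "\<dots> \<le> \<kappa> * x * recip_sum z + 5 * C ^ 3 * x"
    proof (rule Turan_second_moment)
      have "z\<^sup>2 = x powr (2 * \<delta>)"
        using x by (simp add: z_def powr_power mult.commute)
      then have "x powr \<theta> * z\<^sup>2 = x powr (\<theta> + 2 * \<delta>)"
        by (simp add: powr_add)
      also have "\<theta> + 2 * \<delta> = 1" by (simp add: \<delta>_def field_simps)
      finally show "x powr \<theta> * z\<^sup>2 \<le> x" using x by simp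
    qed (use x z in auto)
    also have "\<dots> \<le> \<kappa> * x * ((1 + \<epsilon>) * u) + 5 * C ^ 3 * x * u"
    proof (intro add_mono mult_left_mono L_le)
      have "5 * C ^ 3 * x * 1 \<le> 5 * C ^ 3 * x * u"
        using x u1 C_ge_1 by (intro mult_left_mono) auto
      then show "5 * C ^ 3 * x \<le> 5 * C ^ 3 * x * u" by simp
    qed (use x \<kappa>_pos in simp)
    also have "\<dots> = x * l * u" by (simp add: l_def algebra_simps)
    also have "\<dots> \<le> y * l * u" using x l0 u1 by (intro mult_right_mono) auto
    also have "\<dots> \<le> y * (\<eta> * \<epsilon>\<^sup>2 * u / 4) * u" using u3 y u1 by (intro mult_right_mono mult_left_mono) auto
    also have "\<dots> = \<eta> * y * (\<epsilon> / 2 * u)\<^sup>2" by (simp add: power2_eq_square)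
    finally have "real (card B) \<le> \<eta> * y" using \<epsilon> u1 by (simp add: mult_le_cancel_right)
    then show ?case using x(5) by (simp add: B_def u_def)
  qed
qed

section \<open>Counting h-full elements\<close>

text \<open>
  The summands that remain after splitting off the \<open>h\<close>-th power in \<open>h_full_decomposition\<close>.
\<close>

definition cofactors :: "nat \<Rightarrow> 'p multiset set" where
  "cofactors h = {b \<in> free_abelian_monoid P. \<forall>p. count b p = 0 \<or> h < count b p \<and> count b p < 2 * h}"

text \<open>
  In the Euler product over the cofactors, the factor at \<open>p\<close> is \<open>1\<close> plus fewer than \<open>h\<close> terms, none larger
  than \<open>N p powr - ((h + 1) * s)\<close>, and the sum of these over all generators converges.
\<close>

lemma cofactors_powr_sum_le:
  assumes h: "h \<ge> 1" and s: "s > 0" "real (h + 1) * s > 1"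
  obtains S where "S > 0"
    "\<And>T. finite T \<Longrightarrow> T \<subseteq> cofactors h \<Longrightarrow> (\<Sum>b\<in>T. nrm b powr - s) \<le> S"
proof
  define S where "S = exp (real h * (2 * C / (1 - 2 powr (1 - real (h + 1) * s))))"
  show "S > 0" by (simp add: S_def)
  fix T assume T: "finite T" "T \<subseteq> cofactors h"
  define Q where "Q = (\<Union>b\<in>T. set_mset b)"
  have Q: "finite Q" "Q \<subseteq> P"
    using T by (auto simp: Q_def cofactors_def free_abelian_monoid_def)
  have Npos: "N p > 0" "real (N p) \<ge> 2" if "p \<in> Q" for p
    using that Q N_gt_1[of p] N_ge_2[of p] by auto
  define J where "J = {h + 1..<2 * h}"
  have "(\<Sum>b\<in>T. nrm b powr - s) \<le> (\<Prod>p\<in>Q. \<Sum>j\<in>insert 0 J. (real (N p) powr - s) ^ j)"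
  proof (rule Euler_product_le[OF Q(1)])
    fix b assume b: "b \<in> T"
    then have "count b p = 0 \<or> h < count b p \<and> count b p < 2 * h" for p
      using subsetD[OF T(2) b] unfolding cofactors_def by blast
    then show "set_mset b \<subseteq> Q \<and> (\<forall>p\<in>Q. count b p \<in> insert 0 J)"
      using b by (auto simp: Q_def J_def Suc_le_eq)
  qed (use T Npos in \<open>auto simp: J_def\<close>)
  also have "\<dots> \<le> exp (\<Sum>p\<in>Q. real h * real (N p) powr - (real (h + 1) * s))"
  proof (rule prod_le_exp_sum[OF Q(1)])
    fix p assume p: "p \<in> Q"
    define v where "v = real (N p) powr - s"
    have v: "0 < v" "v \<le> 1"
      using Npos[OF p] s powr_mono[of "- s" 0 "real (N p)"] by (auto simp: v_def)
    have "(\<Sum>j\<in>insert 0 J. v ^ j) = 1 + (\<Sum>j\<in>J. v ^ j)" by (simp add: J_def)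
    also have "(\<Sum>j\<in>J. v ^ j) \<le> (\<Sum>j\<in>J. v ^ (h + 1))"
      using v by (intro sum_mono power_decreasing) (auto simp: J_def)
    also have "\<dots> = real (card J) * v ^ (h + 1)" by simp
    also have "\<dots> \<le> real h * v ^ (h + 1)"
      using v by (intro mult_right_mono) (auto simp: J_def)
    also have "1 + real h * v ^ (h + 1) \<le> exp (real h * v ^ (h + 1))"
      by (rule exp_ge_add_one_self)
    also have "v ^ (h + 1) = real (N p) powr - (real (h + 1) * s)"
      using Npos[OF p] by (simp add: v_def powr_power algebra_simps del: power_Suc)
    finally show "(\<Sum>j\<in>insert 0 J. (real (N p) powr - s) ^ j)
        \<le> exp (real h * real (N p) powr - (real (h + 1) * s))"
      by (simp add: v_def)
  qed (simp add: sum_nonneg)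
  also have "\<dots> \<le> S"
    unfolding S_def sum_distrib_left[symmetric] exp_le_cancel_iff
    by (intro mult_left_mono N_powr_sum_le Q s) simp
  finally show "(\<Sum>b\<in>T. nrm b powr - s) \<le> S" .
qed

lemma h_full_upto_cover:
  assumes h: "h \<ge> 1" and m: "m \<in> h_full_upto P N h x"
  obtains a b where "m = repeat_mset h a + b" "b \<in> cofactors h" "b \<in> elems_upto x"
    "a \<in> elems_upto ((x / nrm b) powr (1 / real h))"
proof -
  have mM: "m \<in> free_abelian_monoid P" and mh: "h_full h m" and mx: "nrm m \<le> x"
    using m by (auto simp: h_full_upto_def)
  obtain a b where ab: "m = repeat_mset h a + b"
    and bc: "\<And>p. count b p = 0 \<or> h < count b p \<and> count b p < 2 * h"
    using h_full_decomposition[OF h mh] by blast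
  have aM: "a \<in> free_abelian_monoid P" and bM: "b \<in> free_abelian_monoid P"
    using mM h by (auto simp: ab free_abelian_monoid_def set_mset_repeat_mset)
  have nm: "nrm m = nrm a ^ h * nrm b" by (simp add: ab norm_ext_add norm_ext_repeat)
  have a1: "nrm a \<ge> 1" and b1: "nrm b \<ge> 1" using nrm_ge_1 aM bM by auto
  have "1 * nrm b \<le> nrm a ^ h * nrm b"
    using a1 b1 by (intro mult_right_mono one_le_power) auto
  then have "b \<in> elems_upto x" using bM mx nm by (simp add: elems_upto_def)
  have "nrm a ^ h \<le> x / nrm b" using mx nm b1 by (simp add: field_simps)
  then have "(nrm a ^ h) powr (1 / real h) \<le> (x / nrm b) powr (1 / real h)"
    using a1 by (intro powr_mono2) auto
  moreover have "(nrm a ^ h) powr (1 / real h) = nrm a"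
    using a1 h by (simp add: powr_realpow[symmetric] powr_powr)
  ultimately have "a \<in> elems_upto ((x / nrm b) powr (1 / real h))" using aM by (simp add: elems_upto_def)
  then show thesis using that ab bM bc \<open>b \<in> elems_upto x\<close> by (auto simp: cofactors_def)
qed

text \<open>
  The union bound over the cofactors, with the linear bound for the number of admissible \<open>a\<close>.
\<close>

lemma card_cover_le:
  assumes T: "finite T" "T \<subseteq> elems_upto x" and W: "\<And>m. m \<in> W \<Longrightarrow>
      \<exists>a. \<exists>b\<in>T. m = repeat_mset h a + b \<and> a \<in> elems_upto ((x / nrm b) powr (1 / real h))"
  shows "real (card W) \<le> C * x powr (1 / real h) * (\<Sum>b\<in>T. nrm b powr - (1 / real h))"
proof -
  let ?U = "\<lambda>b. (\<lambda>a. repeat_mset h a + b) ` elems_upto ((x / nrm b) powr (1 / real h))"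
  have "W \<subseteq> (\<Union>b\<in>T. ?U b)" using W by blast
  then have "card W \<le> card (\<Union>b\<in>T. ?U b)" using T by (intro card_mono) auto
  also have "\<dots> \<le> (\<Sum>b\<in>T. card (?U b))" by (rule card_UN_le[OF T(1)])
  finally have "real (card W) \<le> (\<Sum>b\<in>T. real (card (?U b)))"
    unfolding of_nat_sum[symmetric] of_nat_le_iff .
  also have "\<dots> \<le> (\<Sum>b\<in>T. C * (x / nrm b) powr (1 / real h))"
  proof (rule sum_mono)
    fix b assume "b \<in> T"
    then have b: "nrm b \<ge> 1" "nrm b \<le> x" using T nrm_ge_1 by (auto simp: elems_upto_def)
    have "real (card (?U b)) \<le> real (card (elems_upto ((x / nrm b) powr (1 / real h))))"
      by (simp add: card_image_le)
    also have "\<dots> \<le> C * (x / nrm b) powr (1 / real h)"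
      using b by (intro count_bounds ge_one_powr_ge_zero) (auto simp: le_divide_eq)
    finally show "real (card (?U b)) \<le> C * (x / nrm b) powr (1 / real h)" .
  qed
  also have "\<dots> = (\<Sum>b\<in>T. C * x powr (1 / real h) * nrm b powr - (1 / real h))"
    using T nrm_ge_1 by (intro sum.cong refl) (fastforce simp: elems_upto_def powr_divide powr_minus_divide)
  finally show ?thesis by (simp add: sum_distrib_left)
qed

lemma finite_h_full_upto: "finite (h_full_upto P N h x)"
  by (rule finite_subset[OF _ finite_elems_upto[of x]]) (auto simp: h_full_upto_def elems_upto_def)

text \<open>
  The \<open>h\<close>-th powers of the elements up to \<open>x powr (1 / h)\<close> already suffice.
\<close>

lemma card_h_full_upto_ge:
  assumes h: "h \<ge> 1" and x: "x \<ge> 1"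
  shows "c * x powr (1 / real h) \<le> real (card (h_full_upto P N h x))"
proof -
  have "repeat_mset h ` elems_upto (x powr (1 / real h)) \<subseteq> h_full_upto P N h x"
  proof safe
    fix a assume a: "a \<in> elems_upto (x powr (1 / real h))"
    then have "nrm a ^ h \<le> (x powr (1 / real h)) ^ h"
      by (intro power_mono) (auto simp: elems_upto_def)
    also have "\<dots> = x" using x h by (simp add: powr_power)
    finally show "repeat_mset h a \<in> h_full_upto P N h x"
      using a h by (auto simp: h_full_upto_def elems_upto_def free_abelian_monoid_def h_full_def norm_ext_repeat set_mset_repeat_mset)
  qed
  moreover have "inj_on (repeat_mset h) (elems_upto (x powr (1 / real h)))"
    using h by (intro inj_onI) (metis repeat_mset_cancel1 not_one_le_zero)
  ultimately have "card (elems_upto (x powr (1 / real h))) \<le> card (h_full_upto P N h x)"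
    using card_inj_on_le finite_h_full_upto by blast
  moreover have "c * x powr (1 / real h) \<le> real (card (elems_upto (x powr (1 / real h))))"
    using x by (intro count_bounds ge_one_powr_ge_zero) auto
  ultimately show ?thesis by linarith
qed

text \<open>
  Convergence at an exponent strictly below \<open>1 / h\<close> leaves room to make tails of the sum at \<open>1 / h\<close>
  quantitatively small.
\<close>

lemma powr_sum_cofactors_bounded:
  assumes h: "h \<ge> 1"
  obtains s S where "0 < s" "s < 1 / real h" "S > 0"
    "\<And>T. finite T \<Longrightarrow> T \<subseteq> cofactors h \<Longrightarrow> (\<Sum>b\<in>T. nrm b powr - s) \<le> S"
proof -
  \<comment> \<open>A number strictly between \<open>1 / (h + 1)\<close> and \<open>1 / h\<close>.\<close>
  define s where "s = 2 / (2 * real h + 1)"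
  have s: "0 < s" "real (h + 1) * s > 1" "s < 1 / real h"
    using h by (simp_all add: s_def field_simps)
  from cofactors_powr_sum_le[OF h s(1,2)] obtain S where "S > 0"
    "\<And>T. finite T \<Longrightarrow> T \<subseteq> cofactors h \<Longrightarrow> (\<Sum>b\<in>T. nrm b powr - s) \<le> S" by blast
  with that s show thesis by blast
qed

lemma card_h_full_upto_le:
  assumes h: "h \<ge> 1"
  obtains S where "S > 0" "\<And>x. real (card (h_full_upto P N h x)) \<le> S * x powr (1 / real h)"
proof -
  obtain s S where s: "0 < s" "s < 1 / real h" and S: "S > 0"
    "\<And>T. finite T \<Longrightarrow> T \<subseteq> cofactors h \<Longrightarrow> (\<Sum>b\<in>T. nrm b powr - s) \<le> S"
    using powr_sum_cofactors_bounded[OF h] by metis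
  have "real (card (h_full_upto P N h x)) \<le> C * S * x powr (1 / real h)" for x
  proof -
    let ?T = "cofactors h \<inter> elems_upto x"
    have "real (card (h_full_upto P N h x)) \<le> C * x powr (1 / real h) * (\<Sum>b\<in>?T. nrm b powr - (1 / real h))"
    proof (rule card_cover_le)
      fix m assume "m \<in> h_full_upto P N h x"
      from h_full_upto_cover[OF h this]
      show "\<exists>a. \<exists>b\<in>?T. m = repeat_mset h a + b \<and> a \<in> elems_upto ((x / nrm b) powr (1 / real h))"
        by (metis IntI)
    qed auto
    also have "\<dots> \<le> C * x powr (1 / real h) * (\<Sum>b\<in>?T. nrm b powr - s)"
    proof (intro mult_left_mono sum_mono powr_mono)
      fix b assume "b \<in> ?T"
      then show "1 \<le> nrm b" using nrm_ge_1 by (auto simp: cofactors_def)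
    qed (use s C_ge_1 in auto)
    also have "\<dots> \<le> C * x powr (1 / real h) * S"
      using C_ge_1 by (intro mult_left_mono S) auto
    finally show ?thesis by (simp add: mult_ac)
  qed
  moreover have "C * S > 0" using C_ge_1 S by simp
  ultimately show thesis using that by blast
qed

section \<open>The normal order on h-full elements\<close>

text \<open>
  Discarding the elements of norm at most \<open>sqrt x\<close> makes \<open>ln (ln (nrm m))\<close> differ from \<open>ln (ln x)\<close> by at most \<open>ln 2\<close>.
\<close>

lemma few_h_full_small_norm:
  assumes h: "h \<ge> 1" and \<rho>: "\<rho> > 0"
  shows "eventually (\<lambda>x. real (card {m \<in> h_full_upto P N h x. nrm m \<le> sqrt x})
    \<le> \<rho> * x powr (1 / real h)) at_top"
proof -
  define r where "r = 1 / real h"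
  have r: "r > 0" using h by (simp add: r_def)
  obtain S where S: "S > 0" "\<And>x. real (card (h_full_upto P N h x)) \<le> S * x powr r"
    using card_h_full_upto_le[OF h] unfolding r_def by metis
  show ?thesis using eventually_ge_at_top[of 1] eventually_ge_at_top[of "(S / \<rho>) powr (2 / r)"]
    unfolding r_def[symmetric]
  proof eventually_elim
    case (elim x)
    have "{m \<in> h_full_upto P N h x. nrm m \<le> sqrt x} \<subseteq> h_full_upto P N h (sqrt x)"
      by (auto simp: h_full_upto_def)
    then have "real (card {m \<in> h_full_upto P N h x. nrm m \<le> sqrt x}) \<le> real (card (h_full_upto P N h (sqrt x)))"
      using finite_h_full_upto by (simp add: card_mono)
    also have "\<dots> \<le> S * (sqrt x) powr r" by (rule S)
    also have "\<dots> = S * x powr (r / 2)"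
      using elim by (simp add: powr_half_sqrt[symmetric] powr_powr)
    also have "\<dots> \<le> \<rho> * x powr (r / 2) * x powr (r / 2)"
    proof (intro mult_right_mono)
      have "S / \<rho> = ((S / \<rho>) powr (2 / r)) powr (r / 2)"
        using S \<rho> r by (simp add: powr_powr)
      also have "\<dots> \<le> x powr (r / 2)" using elim(2) r by (intro powr_mono2) auto
      finally show "S \<le> \<rho> * x powr (r / 2)" using \<rho> by (simp add: field_simps)
    qed simp
    also have "\<dots> = \<rho> * x powr r" by (simp add: powr_add[symmetric])
    finally show ?case .
  qed
qed

text \<open>
  Tail estimate: for \<open>nrm b > B\<close>, the term \<open>nrm b powr - (1 / h)\<close> is smaller than \<open>nrm b powr - s\<close>
  by the factor \<open>B powr - (1 / h - s)\<close>.
\<close>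

lemma few_h_full_large_cofactor:
  assumes h: "h \<ge> 1" and \<rho>: "\<rho> > 0"
  obtains B where "B \<ge> 1"
    "\<And>x. real (card {m \<in> h_full_upto P N h x. \<exists>a b. m = repeat_mset h a + b \<and> b \<in> cofactors h \<and>
       b \<in> elems_upto x \<and> B < nrm b \<and> a \<in> elems_upto ((x / nrm b) powr (1 / real h))}) \<le> \<rho> * x powr (1 / real h)"
proof -
  define r where "r = 1 / real h"
  obtain s S where s: "0 < s" "s < r" and S: "S > 0"
    "\<And>T. finite T \<Longrightarrow> T \<subseteq> cofactors h \<Longrightarrow> (\<Sum>b\<in>T. nrm b powr - s) \<le> S"
    using powr_sum_cofactors_bounded[OF h] unfolding r_def by metis
  have CS: "C * S > 0" using C_ge_1 S by simp
  define B where "B = max 1 ((C * S / \<rho>) powr (1 / (r - s)))"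
  have B1: "B \<ge> 1" by (simp add: B_def)
  have "C * S / \<rho> = ((C * S / \<rho>) powr (1 / (r - s))) powr (r - s)"
    using s CS \<rho> by (simp add: powr_powr)
  also have "\<dots> \<le> B powr (r - s)" using s by (intro powr_mono2) (auto simp: B_def)
  finally have B: "C * S \<le> \<rho> * B powr (r - s)" using \<rho> by (simp add: field_simps)
  have "real (card {m \<in> h_full_upto P N h x. \<exists>a b. m = repeat_mset h a + b \<and> b \<in> cofactors h \<and>
       b \<in> elems_upto x \<and> B < nrm b \<and> a \<in> elems_upto ((x / nrm b) powr r)}) \<le> \<rho> * x powr r" (is "real (card ?W) \<le> _") for x
  proof -
    let ?T = "{b \<in> cofactors h \<inter> elems_upto x. B < nrm b}"
    have "real (card ?W) \<le> C * x powr r * (\<Sum>b\<in>?T. nrm b powr - r)"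
      unfolding r_def by (rule card_cover_le) auto
    also have "\<dots> \<le> C * x powr r * (\<Sum>b\<in>?T. B powr - (r - s) * nrm b powr - s)"
    proof (intro mult_left_mono sum_mono)
      fix b assume b: "b \<in> ?T"
      have "nrm b powr - r = nrm b powr - (r - s) * nrm b powr - s"
        by (simp add: powr_add[symmetric])
      also have "\<dots> \<le> B powr - (r - s) * nrm b powr - s"
        using b B1 s by (intro mult_right_mono powr_mono2') auto
      finally show "nrm b powr - r \<le> B powr - (r - s) * nrm b powr - s" .
    qed (use C_ge_1 in simp)
    also have "\<dots> \<le> C * x powr r * (B powr - (r - s) * S)"
      unfolding sum_distrib_left[symmetric] using C_ge_1
      by (intro mult_left_mono S) auto
    also have "\<dots> = C * S * (B powr - (r - s) * x powr r)" by simp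
    also have "\<dots> \<le> \<rho> * B powr (r - s) * (B powr - (r - s) * x powr r)"
      using B by (intro mult_right_mono) auto
    also have "\<dots> = \<rho> * x powr r * (B powr (r - s) * B powr - (r - s))" by (simp add: mult_ac)
    also have "B powr (r - s) * B powr - (r - s) = B powr (r - s + - (r - s))" by (rule powr_add[symmetric])
    also have "\<rho> * x powr r * \<dots> = \<rho> * x powr r" using B1 by simp
    finally show ?thesis .
  qed
  with that B1 show thesis unfolding r_def by blast
qed

lemma omega_le_nrm:
  assumes "b \<in> free_abelian_monoid P"
  shows "real (omega b) \<le> nrm b"
proof -
  have "omega b \<le> size b"
    unfolding omega_eq_card_set_mset size_multiset_overloaded_eq
    using sum_mono[of "set_mset b" "\<lambda>_. 1" "count b"] by (simp add: Suc_le_eq)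
  moreover have "real (size b) < 2 ^ size b" by (rule of_nat_less_two_power)
  ultimately show ?thesis using nrm_ge_power_size[OF assms] by linarith
qed

text \<open>
  For a bounded cofactor \<open>b\<close>, passing from \<open>m\<close> to \<open>a\<close> changes both \<open>omega\<close> and the iterated logarithm by
  bounded amounts, so an exceptional \<open>m\<close> forces \<open>a\<close> to be exceptional, with \<open>\<epsilon> / 2\<close> in place of \<open>\<epsilon>\<close>,
  among the elements up to \<open>(x / nrm b) powr (1 / h)\<close>.
\<close>

lemma deviation_descends:
  assumes h: "h \<ge> 1" and \<epsilon>: "\<epsilon> > 0"
    and m: "m = repeat_mset h a + b" and b: "b \<in> free_abelian_monoid P" "nrm b \<le> B"
    and mx: "sqrt x < nrm m" "nrm m \<le> x"
    and x: "x \<ge> exp 1" "x \<ge> B\<^sup>2"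
      "\<epsilon> * ln 2 + B + (1 + \<epsilon> / 2) * (ln 2 + ln (real h)) + ln 2 \<le> \<epsilon> / 2 * ln (ln x)"
    and dev: "\<epsilon> * ln (ln (nrm m)) < \<bar>real (omega m) - ln (ln (nrm m))\<bar>"
  shows "\<epsilon> / 2 * ln (ln ((x / nrm b) powr (1 / real h)))
    < \<bar>real (omega a) - ln (ln ((x / nrm b) powr (1 / real h)))\<bar>"
proof -
  define u where "u = ln (ln x)"
  define k where "k = ln 2 + ln (real h)"
  define w where "w = ln (ln (nrm m))"
  define v where "v = ln (ln ((x / nrm b) powr (1 / real h)))"
  have b1: "nrm b \<ge> 1" by (rule nrm_ge_1[OF b(1)])
  have xpos: "x > 0" using x(1) exp_gt_zero[of "1::real"] by linarith
  have lnx: "ln x \<ge> 1" using x(1) xpos by (simp add: ln_ge_iff)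
  have "sqrt x > 0" using xpos by simp
  have "ln (sqrt x) \<le> ln (nrm m)" using mx(1) \<open>sqrt x > 0\<close> by (intro ln_mono) auto
  moreover have "ln (nrm m) \<le> ln x" using mx \<open>sqrt x > 0\<close> by (intro ln_mono) linarith+
  ultimately have l: "ln x / 2 \<le> ln (nrm m)" "ln (nrm m) \<le> ln x"
    using xpos by (simp_all add: ln_sqrt)
  have "ln (ln x / 2) \<le> w" unfolding w_def using l lnx by (intro ln_mono) auto
  moreover have "w \<le> u" unfolding w_def u_def using l lnx by - (rule ln_mono; linarith)
  moreover have "ln (ln x / 2) = u - ln 2" using lnx by (simp add: ln_div u_def)
  ultimately have w: "u - ln 2 \<le> w" "w \<le> u" by simp_all
  have "(nrm b)\<^sup>2 \<le> B\<^sup>2" using b(2) by (intro power_mono) auto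
  then have "x \<ge> (nrm b)\<^sup>2" using x(2) by linarith
  from lnln_compare[OF h x(1) this b1] have v: "\<bar>v - u\<bar> \<le> k"
    by (simp add: v_def u_def k_def)
  have "real (omega b) \<le> B" using omega_le_nrm[OF b(1)] b(2) by linarith
  then have om: "\<bar>real (omega m) - real (omega a)\<bar> \<le> B"
    using omega_repeat_mset_add[OF h, of a b] unfolding m by linarith
  have "\<epsilon> * (u - ln 2) \<le> \<epsilon> * w" using w \<epsilon> by (intro mult_left_mono) auto
  then have 1: "\<epsilon> * u - \<epsilon> * ln 2 \<le> \<epsilon> * w" by (simp add: algebra_simps)
  have "\<epsilon> / 2 * v \<le> \<epsilon> / 2 * (u + k)" using v \<epsilon> by (intro mult_left_mono) auto
  then have 2: "\<epsilon> / 2 * v \<le> \<epsilon> / 2 * u + \<epsilon> / 2 * k" by (simp add: algebra_simps)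
  have "\<epsilon> * ln 2 + B + (1 + \<epsilon> / 2) * k + ln 2 \<le> \<epsilon> / 2 * u"
    using x(3) by (simp add: u_def k_def)
  then have 3: "\<epsilon> * ln 2 + B + k + \<epsilon> / 2 * k + ln 2 \<le> \<epsilon> / 2 * u" by (simp add: algebra_simps)
  have 4: "\<epsilon> * w < \<bar>real (omega m) - w\<bar>" using dev by (simp add: w_def)
  have "\<epsilon> / 2 * v < \<bar>real (omega a) - v\<bar>"
    using om v w 1 2 3 4 by linarith
  then show ?thesis by (simp add: v_def)
qed

text \<open>
  An exceptional \<open>m = h * a + b\<close> has small norm, or a large cofactor, or one of the finitely many bounded
  cofactors together with an exceptional \<open>a\<close>. Each class is allowed a third of the total. The order of
  choices matters: first the bound \<open>B\<close>, then the proportion \<open>\<eta>'\<close> of exceptional \<open>a\<close>, which has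
  to compensate for the number of cofactors up to \<open>B\<close>.
\<close>

theorem h_full_normal_order:
  assumes h: "h \<ge> 1" and \<epsilon>: "\<epsilon> > 0" and \<eta>: "\<eta> > 0"
  shows "eventually (\<lambda>x. real (card {m \<in> h_full_upto P N h x.
            \<epsilon> * ln (ln (nrm m)) < \<bar>real (omega m) - ln (ln (nrm m))\<bar>})
          \<le> \<eta> * real (card (h_full_upto P N h x))) at_top"
proof -
  define r where "r = 1 / real h"
  have r: "r > 0" using h by (simp add: r_def)
  \<comment> \<open>The total is at least \<open>c * x powr r\<close>.\<close>
  define \<rho> where "\<rho> = \<eta> * c / 3"
  have \<rho>: "\<rho> > 0" using \<eta> c_pos by (simp add: \<rho>_def)
  obtain B where B1: "B \<ge> 1" and large_cofactor:
    "\<And>x. real (card {m \<in> h_full_upto P N h x. \<exists>a b. m = repeat_mset h a + b \<and> b \<in> cofactors h \<and>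
       b \<in> elems_upto x \<and> B < nrm b \<and> a \<in> elems_upto ((x / nrm b) powr r)}) \<le> \<rho> * x powr r"
    by (rule few_h_full_large_cofactor[OF h \<rho>, folded r_def]) blast
  define T where "T = cofactors h \<inter> elems_upto B"
  have T: "finite T" by (simp add: T_def)
  have Tb: "1 \<le> nrm b" "nrm b \<le> B" "b \<in> free_abelian_monoid P" if "b \<in> T" for b
    using that nrm_ge_1[of b] by (auto simp: T_def elems_upto_def)
  define \<eta>' where "\<eta>' = \<rho> / (real (card T) + 1)"
  have \<eta>': "\<eta>' > 0" "real (card T) * \<eta>' \<le> \<rho>"
    using \<rho> by (auto simp: \<eta>'_def field_simps)
  define bad where "bad = (\<lambda>y. {a \<in> elems_upto y. \<epsilon> / 2 * ln (ln y) < \<bar>real (omega a) - ln (ln y)\<bar>})"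
  have "eventually (\<lambda>y. real (card (bad y)) \<le> \<eta>' * y) at_top"
    unfolding bad_def using \<epsilon> \<eta>' by (intro normal_order) auto
  then obtain y0 where y0: "\<And>y. y \<ge> y0 \<Longrightarrow> real (card (bad y)) \<le> \<eta>' * y"
    by (auto simp: eventually_at_top_linorder)
  define K where "K = \<epsilon> * ln 2 + B + (1 + \<epsilon> / 2) * (ln 2 + ln (real h)) + ln 2"
  show ?thesis
    using eventually_ge_at_top[of "exp 1"] eventually_ge_at_top[of "B\<^sup>2"]
      eventually_ge_at_top[of "B * (max 0 y0) powr real h"]
      few_h_full_small_norm[OF h \<rho>]
      eventually_lnln_ge[of "K / (\<epsilon> / 2)"]
  proof eventually_elim
    case (elim x)
    define W where "W = h_full_upto P N h x"
    define W0 where "W0 = {m \<in> W. \<epsilon> * ln (ln (nrm m)) < \<bar>real (omega m) - ln (ln (nrm m))\<bar>}"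
    have x1: "x \<ge> 1" using elim(1) exp_ge_add_one_self[of 1] by linarith
    have uK: "K \<le> \<epsilon> / 2 * ln (ln x)" using elim(5) \<epsilon> by (simp add: field_simps)
    define W1 where "W1 = {m \<in> W. nrm m \<le> sqrt x}"
    define W2 where "W2 = {m \<in> W. \<exists>a b. m = repeat_mset h a + b \<and> b \<in> cofactors h \<and>
       b \<in> elems_upto x \<and> B < nrm b \<and> a \<in> elems_upto ((x / nrm b) powr r)}"
    define U where "U = (\<lambda>b. (\<lambda>a. repeat_mset h a + b) ` bad ((x / nrm b) powr r))"
    define W3 where "W3 = (\<Union>b\<in>T. U b)"
    have W1: "real (card W1) \<le> \<rho> * x powr r"
      using elim(4) by (simp add: W1_def W_def r_def)
    have W2: "real (card W2) \<le> \<rho> * x powr r"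
      using large_cofactor by (simp add: W2_def W_def)
    have "card W3 \<le> (\<Sum>b\<in>T. card (U b))"
      unfolding W3_def by (rule card_UN_le[OF T])
    then have "real (card W3) \<le> (\<Sum>b\<in>T. real (card (U b)))"
      unfolding of_nat_sum[symmetric] of_nat_le_iff .
    also have "\<dots> \<le> (\<Sum>b\<in>T. \<eta>' * x powr r)"
    proof (rule sum_mono)
      fix b assume "b \<in> T"
      note b = Tb(1,2)[OF this]
      have "max 0 y0 = (max 0 y0 powr real h) powr r"
        using h by (simp add: powr_powr r_def)
      also have "\<dots> \<le> (x / nrm b) powr r"
      proof (intro powr_mono2)
        have "max 0 y0 powr real h \<le> x / B" using elim(3) B1 by (simp add: field_simps)
        also have "\<dots> \<le> x / nrm b" using b x1 by (intro divide_left_mono) auto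
        finally show "max 0 y0 powr real h \<le> x / nrm b" .
      qed (use r in auto)
      finally have y: "(x / nrm b) powr r \<ge> y0" by simp
      have "real (card (U b)) \<le> real (card (bad ((x / nrm b) powr r)))"
        by (simp add: U_def card_image_le bad_def)
      also have "\<dots> \<le> \<eta>' * (x / nrm b) powr r" by (rule y0[OF y])
      also have "\<dots> \<le> \<eta>' * x powr r"
      proof (intro mult_left_mono powr_mono2)
        show "x / nrm b \<le> x" using b x1 by (simp add: divide_le_eq)
      qed (use b x1 r \<eta>' in auto)
      finally show "real (card (U b)) \<le> \<eta>' * x powr r" .
    qed
    also have "\<dots> = (real (card T) * \<eta>') * x powr r" by simp
    also have "\<dots> \<le> \<rho> * x powr r" using \<eta>'(2) by (rule mult_right_mono) simp
    finally have W3: "real (card W3) \<le> \<rho> * x powr r" .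

    have sub: "W0 \<subseteq> W1 \<union> W2 \<union> W3"
    proof
      fix m assume m: "m \<in> W0"
      then have "m \<in> h_full_upto P N h x" by (simp add: W0_def W_def)
      from h_full_upto_cover[OF h this] obtain a b where ab: "m = repeat_mset h a + b"
        "b \<in> cofactors h" "b \<in> elems_upto x" "a \<in> elems_upto ((x / nrm b) powr r)" unfolding r_def by metis
      consider "nrm m \<le> sqrt x" | "B < nrm b" | "sqrt x < nrm m" "nrm b \<le> B" by linarith
      then show "m \<in> W1 \<union> W2 \<union> W3"
      proof cases
        case 1
        then show ?thesis using m by (simp add: W0_def W1_def)
      next
        case 2
        then have "m \<in> W2" using ab m unfolding W0_def W2_def by blast
        then show ?thesis by simp
      next
        case 3
        have "b \<in> T" using ab(2) 3(2) by (simp add: T_def elems_upto_def cofactors_def)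
        have "nrm m \<le> x" using m by (simp add: W0_def W_def h_full_upto_def)
        moreover have "\<epsilon> * ln (ln (nrm m)) < \<bar>real (omega m) - ln (ln (nrm m))\<bar>"
          using m by (simp add: W0_def)
        ultimately have "a \<in> bad ((x / nrm b) powr r)"
          using deviation_descends[OF h \<epsilon> ab(1) Tb(3)[OF \<open>b \<in> T\<close>] 3(2,1)] elim(1,2) uK ab(4)
          by (simp add: bad_def r_def K_def)
        then show ?thesis using \<open>b \<in> T\<close> ab(1) by (auto simp: W3_def U_def)
      qed
    qed
    have "finite W" by (simp add: W_def finite_h_full_upto)
    then have "finite W1" "finite W2" by (auto simp: W1_def W2_def)
    moreover have "finite W3" using T by (auto simp: W3_def U_def bad_def)
    ultimately have "card W0 \<le> card (W1 \<union> W2 \<union> W3)"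
      using sub by (intro card_mono) auto
    also have "\<dots> \<le> card W1 + card W2 + card W3"
      by (meson card_Un_le add_le_mono le_refl le_trans)
    finally have "real (card W0) \<le> 3 * \<rho> * x powr r"
      using W1 W2 W3 by linarith
    also have "\<dots> = \<eta> * (c * x powr r)" by (simp add: \<rho>_def)
    also have "\<dots> \<le> \<eta> * real (card W)"
      using card_h_full_upto_ge[OF h x1] \<eta> unfolding W_def r_def by (intro mult_left_mono) auto
    finally show ?case by (simp add: W_def W0_def)
  qed
qed

end

section \<open>From the counting hypothesis to the normal order\<close>

text \<open>
  Where \<open>\<kappa> * x\<close> dominates the error term the linear bounds come from the asymptotic formula, and
  finiteness comes from it as well, since an infinite set would have the count \<open>0\<close>. On the remaining
  bounded range they hold with suitable constants because the count is monotone and at least \<open>1\<close>. The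
  constant \<open>D\<close> bounds the ratio of consecutive points of \<open>X\<close>.
\<close>

lemma counted_monoid_of_counting_condition:
  fixes P :: "'p set" and N :: "'p \<Rightarrow> nat" and X :: "real set" and \<kappa> \<theta> D :: real
  defines "ups \<equiv> \<lambda>y. {m \<in> free_abelian_monoid P. real (norm_ext N m) \<le> y}"
  assumes N: "\<And>p. p \<in> P \<Longrightarrow> N p > 1" and \<kappa>: "\<kappa> > 0" and \<theta>: "0 \<le> \<theta>" "\<theta> < 1"
    and cnt: "counting_condition P N X \<kappa> \<theta>"
    and X_divide: "\<And>x m. x \<in> X \<Longrightarrow> m \<in> free_abelian_monoid P \<Longrightarrow> x / real (norm_ext N m) \<in> X"
    and D: "D \<ge> 1"
    and round: "\<And>y. y \<ge> 1 \<Longrightarrow> \<exists>x\<in>X. 1 \<le> x \<and> x \<le> y \<and> y \<le> D * x \<and>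
      (\<forall>m\<in>free_abelian_monoid P. real (norm_ext N m) \<le> y \<longrightarrow> real (norm_ext N m) \<le> x)"
  obtains c C where "counted_monoid P N X \<kappa> \<theta> c C"
proof -
  have round': "\<exists>x\<in>X. 1 \<le> x \<and> x \<le> y \<and> y \<le> D * x \<and> ups y = ups x" if "y \<ge> 1" for y
    using round[OF that] by (fastforce simp: ups_def)
  define A where "A = (\<lambda>y. real (card (ups y)))"
  obtain K where K: "K > 0"
    and "eventually (\<lambda>x. norm (A x - \<kappa> * x) \<le> K * norm (x powr \<theta>)) (at_top_through X)"
    using cnt unfolding counting_condition_def A_def ups_def by (elim landau_o.bigE)
  then obtain x0 where x0: "\<And>x. x \<ge> x0 \<Longrightarrow> x \<in> X \<Longrightarrow> \<bar>A x - \<kappa> * x\<bar> \<le> K * x powr \<theta>"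
    by (auto simp: at_top_through_def eventually_inf_principal eventually_at_top_linorder)
  \<comment> \<open>From here on the error term is at most half of the main term.\<close>
  define x1 where "x1 = max (max 1 x0) ((2 * K / \<kappa>) powr (1 / (1 - \<theta>)))"
  have x1: "x1 \<ge> 1" "x1 \<ge> x0" "x1 \<ge> (2 * K / \<kappa>) powr (1 / (1 - \<theta>))" by (auto simp: x1_def)
  have main: "K * x powr \<theta> \<le> \<kappa> / 2 * x" if "x \<ge> x1" for x
  proof -
    have "2 * K / \<kappa> = ((2 * K / \<kappa>) powr (1 / (1 - \<theta>))) powr (1 - \<theta>)"
      using K \<kappa> \<theta> by (simp add: powr_powr)
    also have "\<dots> \<le> x powr (1 - \<theta>)" using x1 that \<theta> by (intro powr_mono2) auto
    finally have "K \<le> \<kappa> / 2 * x powr (1 - \<theta>)" using \<kappa> by (simp add: field_simps)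
    then have "K * x powr \<theta> \<le> \<kappa> / 2 * x powr (1 - \<theta>) * x powr \<theta>" by (intro mult_right_mono) auto
    also have "\<dots> = \<kappa> / 2 * x" using x1 that by (simp add: powr_add[symmetric])
    finally show ?thesis .
  qed
  have large: "\<kappa> / 2 * x \<le> A x" "A x \<le> 2 * \<kappa> * x" if "x \<in> X" "x \<ge> x1" for x
  proof -
    have "\<bar>A x - \<kappa> * x\<bar> \<le> \<kappa> / 2 * x" using x0[of x] main[of x] that x1 by linarith
    moreover have "\<kappa> * x > 0" using that x1 \<kappa> by simp
    ultimately show "\<kappa> / 2 * x \<le> A x" "A x \<le> 2 * \<kappa> * x" by linarith+
  qed
  have fin: "finite (ups y)" for y
  proof -
    have "max y x1 * D \<ge> 1" using x1 D mult_mono[of 1 "max y x1" 1 D] by simp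
    then obtain x where x: "x \<in> X" "max y x1 * D \<le> D * x" using round' by blast
    then have "max y x1 \<le> x" using D by (simp add: mult.commute)
    then have "x \<ge> x1" by simp
    then have "\<kappa> / 2 * x > 0" using x1 \<kappa> by simp
    with large(1)[OF x(1) \<open>x \<ge> x1\<close>] have "A x > 0" by linarith
    then have "finite (ups x)" unfolding A_def by (metis card.infinite of_nat_0 less_irrefl)
    moreover have "ups y \<subseteq> ups x" using \<open>max y x1 \<le> x\<close> by (auto simp: ups_def)
    ultimately show ?thesis by (rule rev_finite_subset)
  qed
  have A_mono: "A y \<le> A z" if "y \<le> z" for y z
    using that by (auto simp: A_def ups_def intro!: card_mono fin[unfolded ups_def])
  have A_ge: "A y \<ge> 1" if "y \<ge> 1" for y
  proof -
    have "{#} \<in> ups y" using that by (simp add: ups_def free_abelian_monoid_def)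
    then have "card (ups y) \<noteq> 0" using fin by auto
    then show ?thesis by (simp add: A_def)
  qed
  define y1 where "y1 = D * x1"
  have y1: "y1 \<ge> 1" "y1 \<ge> x1" using D x1 mult_mono[of 1 D 1 x1] mult_mono[of 1 D x1 x1] by (auto simp: y1_def)
  define c where "c = min (\<kappa> / (2 * D)) (1 / y1)"
  \<comment> \<open>The summands serve, in this order, the linear bound for large and for small arguments and
    the error term for large and, together with the second one, for small arguments.\<close>
  define C where "C = 2 * \<kappa> + A y1 + K + \<kappa> * x1"
  have c: "c > 0" using \<kappa> D y1 by (simp add: c_def)
  have pos: "\<kappa> * x1 > 0" "A y1 \<ge> 1" using \<kappa> x1 A_ge[OF y1(1)] by simp_all
  have bounds: "c * y \<le> A y \<and> A y \<le> C * y" if y: "y \<ge> 1" for y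
  proof (cases "y \<ge> y1")
    case True
    obtain x where x: "x \<in> X" "x \<le> y" "y \<le> D * x" "ups y = ups x" using round'[OF y] by blast
    have "D * x1 \<le> D * x" using True x by (simp add: y1_def)
    then have "x \<ge> x1" using D by simp
    note l = large[OF x(1) this]
    have "c * y \<le> \<kappa> / (2 * D) * (D * x)"
      using x y \<kappa> D c by (intro mult_mono) (auto simp: c_def)
    also have "\<dots> = \<kappa> / 2 * x" using D by simp
    finally have "c * y \<le> A y" using l x(4) by (simp add: A_def)
    moreover have "A y \<le> 2 * \<kappa> * y"
    proof -
      have "A y = A x" using x(4) by (simp add: A_def)
      moreover have "2 * \<kappa> * x \<le> 2 * \<kappa> * y" using x(2) \<kappa> by (intro mult_left_mono) auto
      ultimately show ?thesis using l(2) by linarith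
    qed
    moreover have "2 * \<kappa> * y \<le> C * y" using y pos K by (intro mult_right_mono) (auto simp: C_def)
    ultimately show ?thesis by linarith
  next
    case False
    have "c * y \<le> 1 / y1 * y1" using False y y1 by (intro mult_mono) (auto simp: c_def)
    then have "c * y \<le> A y" using A_ge[OF y] y1 by simp
    moreover have "A y \<le> A y1" using False by (intro A_mono) simp
    moreover have "A y1 * 1 \<le> C * y" using y pos K \<kappa> by (intro mult_mono) (auto simp: C_def)
    ultimately show ?thesis by linarith
  qed
  have asymp: "\<bar>A x - \<kappa> * x\<bar> \<le> C * x powr \<theta>" if x: "x \<in> X" "x \<ge> 1" for x
  proof (cases "x \<ge> x1")
    case True
    have "\<bar>A x - \<kappa> * x\<bar> \<le> K * x powr \<theta>" using x0[of x] x True x1 by simp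
    also have "\<dots> \<le> C * x powr \<theta>" using pos \<kappa> by (intro mult_right_mono) (auto simp: C_def)
    finally show ?thesis .
  next
    case False
    then have "A x \<le> A y1" using y1 by (intro A_mono) simp
    moreover have "\<kappa> * x \<le> \<kappa> * x1" "0 \<le> \<kappa> * x" using False \<kappa> x by simp_all
    ultimately have "\<bar>A x - \<kappa> * x\<bar> \<le> C * 1"
      using A_ge[OF x(2)] \<kappa> K pos unfolding C_def mult_1_right abs_le_iff by linarith
    also have "\<dots> \<le> C * x powr \<theta>"
      using x \<theta> pos \<kappa> K by (intro mult_left_mono ge_one_powr_ge_zero) (auto simp: C_def)
    finally show ?thesis .
  qed
  have "counted_monoid P N X \<kappa> \<theta> c C"
  proof
    fix y :: real
    show "finite {m \<in> free_abelian_monoid P. real (norm_ext N m) \<le> y}" using fin[of y] by (simp add: ups_def)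
    assume y: "y \<ge> 1"
    show "c * y \<le> real (card {m \<in> free_abelian_monoid P. real (norm_ext N m) \<le> y})"
      "real (card {m \<in> free_abelian_monoid P. real (norm_ext N m) \<le> y}) \<le> C * y"
      using bounds[OF y] by (simp_all add: A_def ups_def)
    show "\<exists>x\<in>X. 1 \<le> x \<and> x \<le> y \<and> {m \<in> free_abelian_monoid P. real (norm_ext N m) \<le> y} =
      {m \<in> free_abelian_monoid P. real (norm_ext N m) \<le> x}"
      using round'[OF y] unfolding ups_def by blast
  next
    fix x assume "x \<in> X" "x \<ge> 1"
    then show "\<bar>real (card {m \<in> free_abelian_monoid P. real (norm_ext N m) \<le> x}) - \<kappa> * x\<bar> \<le> C * x powr \<theta>"
      using asymp by (simp add: A_def ups_def)
  qed (use N \<kappa> \<theta> c X_divide in auto)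
  then show thesis by (rule that)
qed

lemma round_down_Rats:
  assumes "y \<ge> (1::real)"
  shows "\<exists>x\<in>\<rat>. 1 \<le> x \<and> x \<le> y \<and> y \<le> 2 * x \<and> (\<forall>n::nat. real n \<le> y \<longrightarrow> real n \<le> x)"
proof (intro bexI conjI allI impI)
  show "real_of_int \<lfloor>y\<rfloor> \<in> \<rat>" by simp
  have "\<lfloor>y\<rfloor> \<ge> 1" using assms by simp
  then show "1 \<le> real_of_int \<lfloor>y\<rfloor>" "real_of_int \<lfloor>y\<rfloor> \<le> y" "y \<le> 2 * real_of_int \<lfloor>y\<rfloor>" by linarith+
  show "real n \<le> real_of_int \<lfloor>y\<rfloor>" if "real n \<le> y" for n
    using that le_floor_iff[of "int n" y] by simp
qed

text \<open>
  The largest power of \<open>q\<close> up to \<open>y\<close>.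
\<close>

lemma round_down_powers:
  assumes q: "q > (1::nat)" and y: "y \<ge> 1" and X: "X = {real q powi z | z::int. True}"
  shows "\<exists>x\<in>X. 1 \<le> x \<and> x \<le> y \<and> y \<le> real q * x \<and> (\<forall>n\<in>X. n \<le> y \<longrightarrow> n \<le> x)"
proof -
  define w where "w = \<lfloor>log (real q) y\<rfloor>"
  have pw: "real q powi z = real q powr real_of_int z" for z
    using q by (simp add: powr_real_of_int')
  have "log (real q) y \<ge> 0" using q y by simp
  then have w: "w \<ge> 0" "real_of_int w \<le> log (real q) y" "log (real q) y \<le> real_of_int w + 1"
    unfolding w_def by (simp, linarith+)
  show ?thesis
  proof (intro bexI conjI ballI impI)
    show "real q powi w \<in> X" using X by blast
    show "1 \<le> real q powi w" unfolding pw using q w by (intro ge_one_powr_ge_zero) auto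
    show "real q powi w \<le> y" unfolding pw using q y w by (simp add: le_log_iff)
    have "y \<le> real q powr (real_of_int w + 1)" using q y w by (simp add: log_le_iff)
    then show "y \<le> real q * real q powi w" unfolding pw using q by (simp add: powr_add mult.commute)
    fix n assume n: "n \<in> X" "n \<le> y"
    then obtain z where z: "n = real q powi z" using X by blast
    have "real_of_int z \<le> log (real q) y" using n q y unfolding z pw by (simp add: le_log_iff)
    then have "z \<le> w" by (simp add: w_def le_floor_iff)
    then show "n \<le> real q powi w" unfolding z pw using q by simp
  qed
qed

theorem corollary1p2:
  fixes P :: "'p set" and N :: "'p \<Rightarrow> nat" and X :: "real set"
    and \<kappa> \<theta> \<epsilon> :: real and h :: nat
  assumes "countable P"
    and "\<And>p. p \<in> P \<Longrightarrow> N p > 1"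
    and "X = \<rat> \<or> (\<exists>q::nat. q > 1 \<and> X = {real q powi z | z::int. True})"
    and "\<And>m. m \<in> free_abelian_monoid P \<Longrightarrow> real (norm_ext N m) \<in> X"
    and "\<kappa> > 0" and "0 \<le> \<theta>" and "\<theta> < 1"
    and "counting_condition P N X \<kappa> \<theta>"
    and "h \<ge> 2"
    and "\<epsilon> > 0"
  shows "(\<lambda>x. real (card {m \<in> h_full_upto P N h x. m \<noteq> {#} \<and>
            \<not> ((1 - \<epsilon>) * ln (ln (real (norm_ext N m))) \<le> real (omega m) \<and>
               real (omega m) \<le> (1 + \<epsilon>) * ln (ln (real (norm_ext N m))))}))
         \<in> o[at_top_through X](\<lambda>x. real (card (h_full_upto P N h x)))"
proof -
  have "\<exists>D\<ge>1. \<forall>y\<ge>1. \<exists>x\<in>X. 1 \<le> x \<and> x \<le> y \<and> y \<le> D * x \<and>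
      (\<forall>m\<in>free_abelian_monoid P. real (norm_ext N m) \<le> y \<longrightarrow> real (norm_ext N m) \<le> x)"
    using assms(3)
  proof
    assume "X = \<rat>"
    then show ?thesis using round_down_Rats by (intro exI[of _ 2]) fastforce
  next
    assume "\<exists>q::nat. q > 1 \<and> X = {real q powi z | z::int. True}"
    then obtain q :: nat where q: "q > 1" and X: "X = {real q powi z | z::int. True}" by blast
    show ?thesis
    proof (intro exI[of _ "real q"] conjI allI impI)
      fix y :: real assume "y \<ge> 1"
      from round_down_powers[OF q this X] assms(4)
      show "\<exists>x\<in>X. 1 \<le> x \<and> x \<le> y \<and> y \<le> real q * x \<and>
        (\<forall>m\<in>free_abelian_monoid P. real (norm_ext N m) \<le> y \<longrightarrow> real (norm_ext N m) \<le> x)"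
        by blast
    qed (use q in simp)
  qed
  then obtain D where D: "D \<ge> 1" and round: "\<And>y. y \<ge> 1 \<Longrightarrow> \<exists>x\<in>X. 1 \<le> x \<and> x \<le> y \<and> y \<le> D * x \<and>
      (\<forall>m\<in>free_abelian_monoid P. real (norm_ext N m) \<le> y \<longrightarrow> real (norm_ext N m) \<le> x)"
    by blast
  have X_divide: "x / real (norm_ext N m) \<in> X" if x: "x \<in> X" and m: "m \<in> free_abelian_monoid P" for x m
    using assms(3)
  proof
    assume "X = \<rat>"
    then show ?thesis using x by simp
  next
    assume "\<exists>q::nat. q > 1 \<and> X = {real q powi z | z::int. True}"
    then obtain q :: nat where q: "q > 1" and X: "X = {real q powi z | z::int. True}" by blast
    obtain v w where vw: "x = real q powi v" "real (norm_ext N m) = real q powi w"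
      using x assms(4)[OF m] unfolding X by blast
    have "x / real (norm_ext N m) = real q powi (v - w)"
      unfolding vw using q by (simp add: power_int_diff)
    then show ?thesis unfolding X by blast
  qed
  obtain c C where "counted_monoid P N X \<kappa> \<theta> c C"
    using counted_monoid_of_counting_condition[OF assms(2,5,6,7,8) X_divide D round] by blast
  then interpret counted_monoid P N X \<kappa> \<theta> c C .
  let ?exc = "\<lambda>x. {m \<in> h_full_upto P N h x. m \<noteq> {#} \<and>
      \<not> ((1 - \<epsilon>) * ln (ln (nrm m)) \<le> real (omega m) \<and>
         real (omega m) \<le> (1 + \<epsilon>) * ln (ln (nrm m)))}"
  \<comment> \<open>The two-sided inequality fails exactly when \<open>omega m\<close> deviates from the iterated logarithm
    by more than \<open>\<epsilon>\<close> times the latter.\<close>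
  let ?dev = "\<lambda>x. {m \<in> h_full_upto P N h x. \<epsilon> * ln (ln (nrm m)) < \<bar>real (omega m) - ln (ln (nrm m))\<bar>}"
  have "?exc x \<subseteq> ?dev x" for x
    by (auto simp: algebra_simps)
  then have le: "card (?exc x) \<le> card (?dev x)" for x
    by (intro card_mono finite_subset[OF _ finite_h_full_upto[of h x]]) auto
  show ?thesis
  proof (rule landau_o.smallI)
    fix \<eta> :: real assume "\<eta> > 0"
    then have "eventually (\<lambda>x. real (card (?dev x)) \<le> \<eta> * real (card (h_full_upto P N h x))) at_top"
      using assms(9,10) by (intro h_full_normal_order) auto
    then have "eventually (\<lambda>x. real (card (?exc x)) \<le> \<eta> * real (card (h_full_upto P N h x))) at_top"
      by eventually_elim (use le in \<open>meson of_nat_mono order_trans\<close>)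
    then show "eventually (\<lambda>x. norm (real (card (?exc x))) \<le> \<eta> * norm (real (card (h_full_upto P N h x)))) (at_top_through X)"
      unfolding at_top_through_def eventually_inf_principal by (rule eventually_mono) simp
  qed
qed

end
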